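(* Fix $\beta>0$. Let $f\in\mathscr{H}^2$ and suppose that $f$ has an analytic continuation (of finite order) to $\mathbb{C}_0$ with $\mu_f(\sigma)\leq\beta$ for every $\sigma>0$. Then \[\sigma_{\mathrm{c}}(f)\leq\frac{\beta}{1+2\beta}.\]
   Context: Write $s=\sigma+it$ and, for real $\kappa$, $\mathbb{C}_\kappa=\{s=\sigma+it : \sigma>\kappa\}$. $\mathscr{H}^2$ is the Hilbert space of Dirichlet series $f(s)=\sum_{n\geq1}a_n n^{-s}$ with complex coefficients and $\|f\|_{\mathscr{H}^2}^2=\sum_{n\geq1}|a_n|^2<\infty$; such a series converges absolutely and is analytic in $\mathbb{C}_{1/2}$. An analytic continuation of $f$ to $\mathbb{C}_0$ is an analytic function on $\mathbb{C}_0$ that agrees with the sum of the series wherever the series converges in $\mathbb{C}_0$; it is again denoted $f$. $\sigma_{\mathrm{c}}(f)$ denotes the abscissa of convergence of the Dirichlet series $f$. An analytic function $f$ on $\mathbb{C}_\kappa$ is of finite order in $\mathbb{C}_\kappa$ if for every $\varepsilon>0$ there are constants $A,B$ such that $|f(\sigma+it)|\leq B(1+|t|)^A$ for all $\sigma\geq\kappa+\varepsilon$ and all real $t$. For such $f$ the Lindelöf order function is \[\mu_f(\sigma)=\limsup_{|t|\to\infty}\frac{\log|f(\sigma+it)|}{\log|t|},\qquad \sigma>\kappa.\] Statements about $\mu_f$ on $(\kappa,\infty)$ presuppose that $f$ is of finite order in $\mathbb{C}_\kappa$. *)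

theory Defs
  imports "HOL-Complex_Analysis.Complex_Analysis"
begin

text \<open>
  A Dirichlet series with coefficients \<open>a 1, a 2, \<dots>\<close> is represented by its coefficient function
  \<open>a :: nat \<Rightarrow> complex\<close>; the value \<open>a 0\<close> is never used.
\<close>

definition half_plane :: "real \<Rightarrow> complex set" where
  "half_plane \<kappa> = {s. \<kappa> < Re s}"

definition dirichlet_term :: "(nat \<Rightarrow> complex) \<Rightarrow> complex \<Rightarrow> nat \<Rightarrow> complex" where
  "dirichlet_term a s n = a (Suc n) * of_nat (Suc n) powr (- s)"

definition dirichlet_converges :: "(nat \<Rightarrow> complex) \<Rightarrow> complex \<Rightarrow> bool" where
  "dirichlet_converges a s \<longleftrightarrow> summable (dirichlet_term a s)"

definition dirichlet_sum :: "(nat \<Rightarrow> complex) \<Rightarrow> complex \<Rightarrow> complex" where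
  "dirichlet_sum a s = (\<Sum>n. dirichlet_term a s n)"

definition hardy_H2 :: "(nat \<Rightarrow> complex) set" where
  "hardy_H2 = {a. summable (\<lambda>n. (cmod (a (Suc n)))\<^sup>2)}"

text \<open>
  The abscissa of convergence is extended-real valued: \<open>\<infinity>\<close> if the series converges in no
  half-plane, \<open>-\<infinity>\<close> if it converges everywhere.
\<close>

definition conv_abscissa :: "(nat \<Rightarrow> complex) \<Rightarrow> ereal" where
  "conv_abscissa a = Inf {ereal \<kappa> |\<kappa>. \<forall>s \<in> half_plane \<kappa>. dirichlet_converges a s}"

definition analytic_continuation_to ::
    "(nat \<Rightarrow> complex) \<Rightarrow> real \<Rightarrow> (complex \<Rightarrow> complex) \<Rightarrow> bool" where
  "analytic_continuation_to a \<kappa> f \<longleftrightarrow>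
     f analytic_on half_plane \<kappa> \<and>
     (\<forall>s \<in> half_plane \<kappa>. dirichlet_converges a s \<longrightarrow> f s = dirichlet_sum a s)"

definition finite_order :: "real \<Rightarrow> (complex \<Rightarrow> complex) \<Rightarrow> bool" where
  "finite_order \<kappa> f \<longleftrightarrow>
     f analytic_on half_plane \<kappa> \<and>
     (\<forall>\<epsilon>>0. \<exists>A B :: real. \<forall>\<sigma> t. \<kappa> + \<epsilon> \<le> \<sigma> \<longrightarrow>
        cmod (f (Complex \<sigma> t)) \<le> B * (1 + \<bar>t\<bar>) powr A)"

text \<open>
  Since \<open>ln 0 = 0\<close> for the logarithm on the reals, the convention \<open>log 0 = -\<infinity>\<close>, needed at the zeros
  of the function, is made explicit.
\<close>

definition log_ext :: "real \<Rightarrow> ereal" where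
  "log_ext x = (if x = 0 then -\<infinity> else ereal (ln x))"

text \<open>On the reals, the filter \<open>at_infinity\<close> expresses \<open>\<bar>t\<bar> \<rightarrow> \<infinity>\<close>, in both directions.\<close>

definition lindelof_mu :: "(complex \<Rightarrow> complex) \<Rightarrow> real \<Rightarrow> ereal" where
  "lindelof_mu f \<sigma> =
     Limsup at_infinity (\<lambda>t :: real. log_ext (cmod (f (Complex \<sigma> t))) / ereal (ln \<bar>t\<bar>))"

end

theory Submission
  imports Defs
begin

text \<open>
  Fix \<open>s\<close> with real part \<open>\<sigma> > \<beta> / (1 + 2\<beta>)\<close> and put \<open>g z = f (s + z)\<close>, \<open>d n = a n * n powr -s\<close>. The claim is
  that the partial sums \<open>S N 0\<close>, where \<open>S N z = (\<Sum>n\<le>N. d n * n powr -z)\<close>, tend to \<open>g 0\<close>. As in Newman's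
  proof of Ingham's Tauberian theorem, Cauchy's formula is applied on finite contours of height
  \<open>T\<close> with the kernel \<open>N powr z * (1 + (z/T)\<^sup>2) ^ m / z\<close>, whose residue at \<open>0\<close> is \<open>1\<close>. The
  contour is split at the imaginary axis. On the right part, a three-sided bracket from \<open>-iT\<close> to
  \<open>iT\<close> through the line \<open>Re z = T\<close>, one integrates \<open>g - S N\<close>. On the left, \<open>g\<close> is integrated
  over the bracket through \<open>Re z = -b\<close>, with \<open>b\<close> slightly smaller than \<open>\<sigma>\<close>, whereas the entire
  function \<open>S N\<close> is integrated over the bracket through \<open>Re z = -T\<close>.

  On the sides of the brackets through \<open>\<plusminus>T\<close>, \<open>\<bar>1 + (z/T)\<^sup>2\<bar> \<le> 3 \<bar>Re z\<bar> / T\<close>, so the zero of the kernel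
  at \<open>\<plusminus>iT\<close> replaces the decay that one would otherwise want from a smoothed Perron kernel. It has two effects.
  Near the imaginary axis, where only polynomial bounds for \<open>g\<close> and \<open>S N\<close> are available, it gives
  a factor \<open>T powr -m\<close>, negligible for large \<open>m\<close>. Farther away, the term with index \<open>n\<close> carries
  \<open>(N/n) powr Re z\<close>, which is at most about \<open>exp (-\<theta> \<bar>Re z\<bar> / 2)\<close> unless \<open>\<bar>n - N\<bar> \<le> \<theta> N\<close>; multiplied by
  \<open>(\<bar>Re z\<bar> / T) ^ m\<close> this is \<open>O((T\<theta>) powr -m)\<close>, negligible as soon as \<open>T\<theta>\<close> is a small power of \<open>N\<close>.
  Two contributions remain (lemma \<open>newman_inequality\<close>):

  \<^item> the window \<open>\<bar>n - N\<bar> \<le> \<theta> N\<close>, where \<open>\<theta>\<close> is nearly \<open>1/T\<close>. It has about \<open>N/T\<close> elements, so by Cauchy-Schwarz and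
    square summability it contributes about \<open>N powr -\<sigma> * sqrt (N/T)\<close> (lemma \<open>window_sum_bound\<close>);
  \<^item> the vertical side \<open>Re z = -b\<close>, on which \<open>g\<close> grows at most like \<open>\<bar>y\<bar> powr \<gamma>\<close> with \<open>\<gamma>\<close> slightly larger than
    \<open>\<beta>\<close>. It contributes about \<open>N powr -\<sigma> * T powr \<beta>\<close>.

  The two are balanced for \<open>T = N powr (1 / (1 + 2\<beta>))\<close>, and then both are about
  \<open>N powr (\<beta> / (1 + 2\<beta>) - \<sigma>)\<close>, which tends to \<open>0\<close>. Thus square summability enters through the
  window, the bound for \<open>\<mu>\<close> through the vertical side, and finite order makes the horizontal sides
  negligible.
\<close>

section \<open>Cauchy's formula on brackets\<close>

text \<open>
  The three sides other than the one on the imaginary axis of the rectangle with corners \<open>\<plusminus>iT\<close>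
  and \<open>x \<plusminus> iT\<close>. Since \<open>x\<close> may be negative, one definition serves both halves of the contour.
\<close>

definition bracket :: "real \<Rightarrow> real \<Rightarrow> complex set" where
  "bracket x T = closed_segment (Complex 0 (-T)) (Complex x (-T)) \<union>
     closed_segment (Complex x (-T)) (Complex x T) \<union> closed_segment (Complex x T) (Complex 0 T)"

definition bracket_integral :: "real \<Rightarrow> real \<Rightarrow> (complex \<Rightarrow> complex) \<Rightarrow> complex" where
  "bracket_integral x T F =
     contour_integral (linepath (Complex 0 (-T)) (Complex x (-T))) F +
     contour_integral (linepath (Complex x (-T)) (Complex x T)) F +
     contour_integral (linepath (Complex x T) (Complex 0 T)) F"

lemma closed_segment_same_Im_D:
  assumes "z \<in> closed_segment (Complex a c) (Complex b c)"
  shows "Im z = c" "min a b \<le> Re z" "Re z \<le> max a b"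
proof -
  have "z \<in> closed_segment (Complex a c) (Complex b c) \<longleftrightarrow> Im z = c \<and> Re z \<in> closed_segment a b"
    by (subst closed_segment_same_Im) auto
  then show "Im z = c" "min a b \<le> Re z" "Re z \<le> max a b"
    using assms by (auto simp: closed_segment_eq_real_ivl split: if_splits)
qed

lemma closed_segment_same_Re_D:
  assumes "z \<in> closed_segment (Complex c a) (Complex c b)"
  shows "Re z = c" "min a b \<le> Im z" "Im z \<le> max a b"
proof -
  have "z \<in> closed_segment (Complex c a) (Complex c b) \<longleftrightarrow> Re z = c \<and> Im z \<in> closed_segment a b"
    by (subst closed_segment_same_Re) auto
  then show "Re z = c" "min a b \<le> Im z" "Im z \<le> max a b"
    using assms by (auto simp: closed_segment_eq_real_ivl split: if_splits)
qed

lemma bracketD: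
  assumes "z \<in> bracket x T" "T > 0"
  shows "\<bar>Im z\<bar> \<le> T" "\<bar>Im z\<bar> = T \<or> Re z = x" "min 0 x \<le> Re z" "Re z \<le> max 0 x"
proof -
  consider "z \<in> closed_segment (Complex 0 (-T)) (Complex x (-T))"
    | "z \<in> closed_segment (Complex x (-T)) (Complex x T)"
    | "z \<in> closed_segment (Complex x T) (Complex 0 T)"
    using assms(1) unfolding bracket_def by blast
  then have "\<bar>Im z\<bar> \<le> T \<and> (\<bar>Im z\<bar> = T \<or> Re z = x) \<and> min 0 x \<le> Re z \<and> Re z \<le> max 0 x"
  proof cases
    case 1
    from closed_segment_same_Im_D[OF this] assms(2) show ?thesis by auto
  next
    case 2
    from closed_segment_same_Re_D[OF this] assms(2) show ?thesis by auto
  next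
    case 3
    from closed_segment_same_Im_D[OF this] assms(2) show ?thesis by auto
  qed
  then show "\<bar>Im z\<bar> \<le> T" "\<bar>Im z\<bar> = T \<or> Re z = x" "min 0 x \<le> Re z" "Re z \<le> max 0 x"
    by blast+
qed

lemma bracket_integral_diff:
  assumes "continuous_on (bracket x T) F" "continuous_on (bracket x T) G"
  shows "bracket_integral x T (\<lambda>z. F z - G z) = bracket_integral x T F - bracket_integral x T G"
proof -
  have "F contour_integrable_on linepath p q \<and> G contour_integrable_on linepath p q"
    if "closed_segment p q \<subseteq> bracket x T" for p q
    using that assms by (meson contour_integrable_continuous_linepath continuous_on_subset)
  then have "contour_integral (linepath p q) (\<lambda>z. F z - G z) =
      contour_integral (linepath p q) F - contour_integral (linepath p q) G"
    if "closed_segment p q \<subseteq> bracket x T" for p q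
    using that by (simp add: contour_integral_diff)
  from this[of "Complex 0 (-T)" "Complex x (-T)"] this[of "Complex x (-T)" "Complex x T"]
    this[of "Complex x T" "Complex 0 T"]
  show ?thesis
    unfolding bracket_integral_def by (simp add: bracket_def Un_assoc le_supI1 le_supI2)
qed

lemma bracket_integral_bound:
  assumes "continuous_on (bracket x T) F" "0 \<le> Q" "T > 0" "\<And>z. z \<in> bracket x T \<Longrightarrow> cmod (F z) \<le> Q"
  shows "cmod (bracket_integral x T F) \<le> Q * (2 * \<bar>x\<bar> + 2 * T)"
proof -
  have *: "cmod (contour_integral (linepath p q) F) \<le> Q * cmod (q - p)"
    if "closed_segment p q \<subseteq> bracket x T" for p q
    using that assms
    by (intro contour_integral_bound_linepath contour_integrable_continuous_linepath)
       (auto intro: continuous_on_subset)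
  have len: "cmod (Complex x (-T) - Complex 0 (-T)) = \<bar>x\<bar>" "cmod (Complex 0 T - Complex x T) = \<bar>x\<bar>"
    "cmod (Complex x T - Complex x (-T)) = 2 * T"
    using assms(3) by (simp_all add: cmod_def real_sqrt_mult)
  have "cmod (bracket_integral x T F) \<le> Q * \<bar>x\<bar> + Q * (2 * T) + Q * \<bar>x\<bar>"
    unfolding bracket_integral_def
    by (intro norm_triangle_mono *[of "Complex 0 (-T)" "Complex x (-T)", unfolded len]
        *[of "Complex x (-T)" "Complex x T", unfolded len]
        *[of "Complex x T" "Complex 0 T", unfolded len]) (auto simp: bracket_def)
  then show ?thesis by (simp add: algebra_simps)
qed

text \<open>
  The boundary of a rectangle around \<open>0\<close>, cut at its two points on the imaginary axis. Both
  brackets run upwards from \<open>-iT\<close> to \<open>iT\<close>, whence the minus sign. The right bracket does not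
  depend on \<open>r\<close>, so that two functions with different domains can share it.
\<close>

lemma Cauchy_two_brackets:
  assumes F: "F holomorphic_on {z. - r0 < Re z}" and r: "0 < r" "r < r0" and "R > 0" "T > 0"
  shows "2 * pi * \<i> * F 0 = bracket_integral R T (\<lambda>z. F z / z) - bracket_integral (-r) T (\<lambda>z. F z / z)"
proof -
  let ?H = "{z. - r0 < Re z}"
  let ?G = "\<lambda>z. F z / z"
  let ?p1 = "Complex (-r) (-T)" and ?p3 = "Complex R T"
  let ?p2 = "Complex R (-T)" and ?p4 = "Complex (-r) T"
  have opn: "open ?H" using open_halfspace_Re_gt[of "-r0"] by simp
  have cvx: "convex ?H" using convex_halfspace_Re_gt[of "-r0"] by simp
  have img: "path_image (rectpath ?p1 ?p3) = cbox ?p1 ?p3 - box ?p1 ?p3"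
    using r assms by (intro path_image_rectpath_cbox_minus_box) auto
  have sub: "path_image (rectpath ?p1 ?p3) \<subseteq> ?H - {0}"
    unfolding img using r assms by (auto simp: in_cbox_complex_iff in_box_complex_iff)
  have wn: "winding_number (rectpath ?p1 ?p3) 0 = 1"
    using r assms by (intro winding_number_rectpath) (auto simp: in_box_complex_iff)
  have "((\<lambda>w. F w / (w - 0)) has_contour_integral (2*pi*\<i> * winding_number (rectpath ?p1 ?p3) 0 * F 0))
          (rectpath ?p1 ?p3)"
    using sub r opn interior_open[OF opn]
    by (intro Cauchy_integral_formula_convex_simple[OF cvx F]) auto
  then have int: "(?G has_contour_integral (2*pi*\<i> * F 0)) (rectpath ?p1 ?p3)"
    by (simp add: wn)
  have cont: "continuous_on (?H - {0}) ?G"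
    using holomorphic_on_imp_continuous_on[OF F]
    by (intro continuous_intros) (auto intro: continuous_on_subset)
  have seg: "closed_segment p q \<subseteq> ?H - {0}" 
    if "closed_segment p q \<subseteq> path_image (rectpath ?p1 ?p3)" for p q using that sub by blast
  have im: "path_image (rectpath ?p1 ?p3) = closed_segment ?p1 ?p2 \<union> closed_segment ?p2 ?p3 \<union>
     closed_segment ?p3 ?p4 \<union> closed_segment ?p4 ?p1"
    by (simp add: rectpath_def Let_def path_image_join Un_assoc)
  have c: "continuous_on (closed_segment ?p1 ?p2) ?G" "continuous_on (closed_segment ?p2 ?p3) ?G"
    "continuous_on (closed_segment ?p3 ?p4) ?G" "continuous_on (closed_segment ?p4 ?p1) ?G"
    by (rule continuous_on_subset[OF cont], rule seg, simp add: im, blast?)+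
  have eq: "2*pi*\<i> * F 0 = contour_integral (linepath ?p1 ?p2) ?G + (contour_integral (linepath ?p2 ?p3) ?G
     + (contour_integral (linepath ?p3 ?p4) ?G + contour_integral (linepath ?p4 ?p1) ?G))"
    using contour_integral_unique[OF int] c
    by (simp add: rectpath_def Let_def contour_integrable_continuous_linepath)
  have m1: "Complex 0 (-T) \<in> closed_segment ?p1 ?p2" 
    by (subst closed_segment_same_Im) (use r assms in \<open>auto simp: closed_segment_eq_real_ivl\<close>)
  have m2: "Complex 0 T \<in> closed_segment ?p3 ?p4" 
    by (subst closed_segment_same_Im) (use r assms in \<open>auto simp: closed_segment_eq_real_ivl\<close>)
  have rev: "contour_integral (linepath p q) ?G = - contour_integral (linepath q p) ?G" 
    if "closed_segment p q \<subseteq> path_image (rectpath ?p1 ?p3)" for p q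
    using contour_integral_reverse_linepath[of p q ?G] continuous_on_subset[OF cont seg[OF that]] by simp
  have sub1: "closed_segment ?p1 (Complex 0 (-T)) \<subseteq> closed_segment ?p1 ?p2"
    "closed_segment (Complex 0 T) ?p4 \<subseteq> closed_segment ?p3 ?p4"
    using m1 m2 by (simp_all add: subset_closed_segment)
  have "contour_integral (linepath ?p1 (Complex 0 (-T))) ?G = - contour_integral (linepath (Complex 0 (-T)) ?p1) ?G"
    "contour_integral (linepath (Complex 0 T) ?p4) ?G = - contour_integral (linepath ?p4 (Complex 0 T)) ?G"
    "contour_integral (linepath ?p4 ?p1) ?G = - contour_integral (linepath ?p1 ?p4) ?G"
    by (rule rev, use sub1 im in blast)+
  then show ?thesis
    unfolding eq bracket_integral_def contour_integral_split_linepath[OF c(1) m1]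
      contour_integral_split_linepath[OF c(3) m2] by simp
qed

text \<open>
  The kernel without its pole \<open>1 / z\<close>.
\<close>

definition newman_kernel :: "real \<Rightarrow> real \<Rightarrow> nat \<Rightarrow> complex \<Rightarrow> complex" where
  "newman_kernel X T m z = exp (z * of_real (ln X)) * (1 + (z / of_real T)\<^sup>2) ^ m"

lemma newman_kernel_0 [simp]: "newman_kernel X T m 0 = 1"
  by (simp add: newman_kernel_def)

lemma newman_kernel_holomorphic: "T \<noteq> 0 \<Longrightarrow> newman_kernel X T m holomorphic_on A"
  unfolding newman_kernel_def by (intro holomorphic_intros) auto

text \<open>
  The point of the quadratic factor. On a horizontal side \<open>(Im z)\<^sup>2 = T\<^sup>2\<close>, hence
  \<open>T\<^sup>2 + z\<^sup>2 = Re z * (Re z + 2 i Im z)\<close> vanishes to first order at the imaginary axis. On the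
  far vertical side the right-hand side is \<open>3\<close> and the bound is trivial.
\<close>

lemma newman_factor_bound:
  assumes "T > 0" "\<bar>Im z\<bar> = T \<or> \<bar>Re z\<bar> = T" "\<bar>Im z\<bar> \<le> T" "\<bar>Re z\<bar> \<le> T"
  shows "cmod (1 + (z / of_real T)\<^sup>2) \<le> 3 * \<bar>Re z\<bar> / T"
proof (cases "\<bar>Re z\<bar> = T")
  case True
  have "(cmod z)\<^sup>2 = (Re z)\<^sup>2 + (Im z)\<^sup>2" by (simp add: cmod_power2)
  also have "\<dots> \<le> T\<^sup>2 + T\<^sup>2"
    using assms by (intro add_mono) (auto simp: power2_le_iff_abs_le)
  finally have "(cmod z)\<^sup>2 / T\<^sup>2 \<le> 2" using assms by (simp add: field_simps)
  moreover have "cmod (1 + (z / of_real T)\<^sup>2) \<le> 1 + (cmod z)\<^sup>2 / T\<^sup>2"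
    by (rule order.trans[OF norm_triangle_ineq]) (simp add: norm_power norm_divide power_divide)
  ultimately show ?thesis using True assms by simp
next
  case False
  then have "(Im z)\<^sup>2 = T\<^sup>2" using assms by (metis power2_abs)
  then have "of_real T^2 + z\<^sup>2 = of_real (Re z) * (of_real (Re z) + 2 * \<i> * of_real (Im z))"
    by (auto simp: complex_eq_iff power2_eq_square algebra_simps)
  moreover have "1 + (z / of_real T)\<^sup>2 = (of_real T^2 + z\<^sup>2) / of_real T^2"
    using assms by (simp add: field_simps)
  ultimately have "cmod (1 + (z / of_real T)\<^sup>2) = \<bar>Re z\<bar> * cmod (of_real (Re z) + 2 * \<i> * of_real (Im z)) / T^2"
    using assms by (simp add: norm_mult norm_divide norm_power)
  also have "cmod (of_real (Re z) + 2 * \<i> * of_real (Im z)) \<le> T + 2 * T"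
    by (rule order.trans[OF norm_triangle_ineq]) (use assms in \<open>auto simp: norm_mult\<close>)
  then have "\<bar>Re z\<bar> * cmod (of_real (Re z) + 2 * \<i> * of_real (Im z)) / T^2 \<le> \<bar>Re z\<bar> * (T + 2 * T) / T^2"
    by (intro divide_right_mono mult_left_mono) auto
  also have "\<dots> = 3 * \<bar>Re z\<bar> / T" using assms by (simp add: field_simps power2_eq_square)
  finally show ?thesis .
qed

lemma norm_newman_kernel:
  "X > 0 \<Longrightarrow> cmod (newman_kernel X T m z) = X powr Re z * cmod (1 + (z / of_real T)\<^sup>2) ^ m"
  by (simp add: newman_kernel_def norm_mult norm_power powr_def)

section \<open>Estimates for Dirichlet polynomials and tails\<close>

lemma exp_neg_times_power_le:
  assumes "y \<ge> 0" "m > 0"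
  shows "exp (-y) * y ^ m \<le> real m ^ m"
proof -
  have "(y / m) ^ m \<le> (1 + y / m) ^ m" using assms by (intro power_mono) auto
  also have "\<dots> \<le> exp y" using assms by (intro exp_ge_one_plus_x_over_n_power_n) auto
  finally have "y ^ m \<le> real m ^ m * exp y" using assms by (simp add: power_divide field_simps)
  then show ?thesis by (simp add: exp_minus field_simps)
qed

text \<open>
  Trades the exponential damping of the coefficients away from the cut-off for a power of
  \<open>T\<theta>\<close>, uniformly in the distance \<open>x\<close> from the imaginary axis.
\<close>

lemma damped_power_le:
  assumes "x \<ge> 0" "m > 0" "T > 0" "\<theta> > 0"
  shows "exp (-(\<theta> * x / 2)) * (3 * x / T) ^ m \<le> (6 * real m / (T * \<theta>)) ^ m"
proof -
  have "3 * x / T = 6 / (T * \<theta>) * (\<theta> * x / 2)" using assms by simp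
  then have "exp (-(\<theta> * x / 2)) * (3 * x / T) ^ m = (6 / (T * \<theta>)) ^ m * (exp (-(\<theta> * x / 2)) * (\<theta> * x / 2) ^ m)"
    by (simp only: power_mult_distrib mult_ac)
  also have "\<dots> \<le> (6 / (T * \<theta>)) ^ m * real m ^ m"
    using assms by (intro mult_left_mono exp_neg_times_power_le) auto
  also have "\<dots> = (6 * real m / (T * \<theta>)) ^ m"
    by (simp only: power_mult_distrib[symmetric] times_divide_eq_left)
  finally show ?thesis .
qed

text \<open>
  Positions \<open>n\<close> stand for the index \<open>Suc n\<close>, as in \<^const>\<open>dirichlet_term\<close>.
\<close>

definition window :: "nat \<Rightarrow> real \<Rightarrow> nat set" where
  "window N \<theta> = {n. real N * (1 - \<theta>) \<le> real (Suc n) \<and> real (Suc n) \<le> real N * (1 + \<theta>)}"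

lemma finite_window: "finite (window N \<theta>)"
proof (rule finite_subset)
  show "window N \<theta> \<subseteq> {..nat \<lceil>real N * (1 + \<theta>)\<rceil>}"
  proof
    fix n assume "n \<in> window N \<theta>"
    then have "real n \<le> real N * (1 + \<theta>)" by (simp add: window_def)
    also have "\<dots> \<le> real (nat \<lceil>real N * (1 + \<theta>)\<rceil>)" by (rule real_nat_ceiling_ge)
    finally show "n \<in> {..nat \<lceil>real N * (1 + \<theta>)\<rceil>}" by simp
  qed
qed simp

abbreviation dirichlet_partial :: "(nat \<Rightarrow> complex) \<Rightarrow> nat \<Rightarrow> complex \<Rightarrow> complex" where
  "dirichlet_partial d N z \<equiv> \<Sum>n<N. d n * of_nat (Suc n) powr (-z)"

abbreviation window_sum :: "(nat \<Rightarrow> complex) \<Rightarrow> nat \<Rightarrow> real \<Rightarrow> real" where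
  "window_sum d N \<theta> \<equiv> \<Sum>n\<in>window N \<theta>. cmod (d n)"

lemma norm_dirichlet_term: "cmod (d * of_nat (Suc n) powr (-z)) = cmod d * real (Suc n) powr (- Re z)"
  using norm_powr_real_powr[of "of_nat (Suc n)" "-z"] by (simp add: norm_mult)

text \<open>
  Left of the imaginary axis, \<open>(n/N) powr \<bar>Re z\<bar>\<close> is at most \<open>1\<close> for \<open>n \<le> N\<close>, and it is at most
  \<open>(1 - \<theta>) powr \<bar>Re z\<bar>\<close> below the window.
\<close>

lemma dirichlet_partial_left_bound:
  assumes N: "N > 0" and \<theta>: "0 < \<theta>" "\<theta> \<le> 1/2" and M: "\<And>n. cmod (d n) \<le> M" and x: "Re z \<le> 0"
  shows "cmod (dirichlet_partial d N z) * real N powr Re z \<le> window_sum d N \<theta> + real N * M * exp (-(\<theta> * \<bar>Re z\<bar> / 2))"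
proof -
  let ?X = "real N" and ?x = "-Re z"
  let ?e = "exp (-(\<theta> * \<bar>Re z\<bar> / 2))"
  have M0: "M \<ge> 0" using M[of 0] norm_ge_zero order_trans by blast
  have "cmod (dirichlet_partial d N z) * ?X powr Re z \<le> (\<Sum>n<N. cmod (d n) * real (Suc n) powr ?x) * ?X powr Re z"
    unfolding norm_dirichlet_term[symmetric] by (intro mult_right_mono norm_sum) auto
  also have "\<dots> = (\<Sum>n<N. cmod (d n) * (real (Suc n) / ?X) powr ?x)"
    unfolding sum_distrib_right
    by (intro sum.cong) (use N in \<open>auto simp: powr_divide powr_minus field_simps\<close>)
  also have "\<dots> \<le> (\<Sum>n<N. (if n \<in> window N \<theta> then cmod (d n) else 0) + M * ?e)"
  proof (rule sum_mono)
    fix n assume "n \<in> {..<N}"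
    then have n: "real (Suc n) \<le> ?X" by simp
    show "cmod (d n) * (real (Suc n) / ?X) powr ?x \<le> (if n \<in> window N \<theta> then cmod (d n) else 0) + M * ?e"
    proof (cases "n \<in> window N \<theta>")
      case True
      have "(real (Suc n) / ?X) powr ?x \<le> 1"
        using n N x by (intro powr_le1) auto
      then have "cmod (d n) * (real (Suc n) / ?X) powr ?x \<le> cmod (d n) * 1"
        by (rule mult_left_mono) auto
      moreover have "0 \<le> M * ?e" using M0 by simp
      ultimately show ?thesis using True by simp
    next
      case False
      moreover have "?X * 1 \<le> ?X * (1 + \<theta>)" using N \<theta> by (intro mult_left_mono) auto
      ultimately have "real (Suc n) < ?X * (1 - \<theta>)" using n by (auto simp: window_def)
      then have "real (Suc n) / ?X \<le> 1 - \<theta>" using N by (simp add: field_simps)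
      also have "\<dots> \<le> exp (-\<theta>)" using exp_ge_add_one_self[of "-\<theta>"] by simp
      finally have "(real (Suc n) / ?X) powr ?x \<le> exp (-\<theta>) powr ?x"
        using x N by (intro powr_mono2) auto
      also have "\<dots> = exp (-(\<theta> * \<bar>Re z\<bar>))" using x by (simp add: powr_def)
      also have "\<dots> \<le> ?e" using \<theta> by simp
      finally have "cmod (d n) * (real (Suc n) / ?X) powr ?x \<le> M * ?e"
        using M M0 by (intro mult_mono) auto
      then show ?thesis using False by simp
    qed
  qed
  also have "\<dots> = (\<Sum>n\<in>{..<N} \<inter> window N \<theta>. cmod (d n)) + real N * M * ?e"
    by (simp add: sum.distrib sum.inter_restrict)
  also have "(\<Sum>n\<in>{..<N} \<inter> window N \<theta>. cmod (d n)) \<le> window_sum d N \<theta>"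
    by (intro sum_mono2 finite_window) auto
  finally show ?thesis by simp
qed

text \<open>
  One factor \<open>r\<close> is kept out of the exponential: with \<open>r = N/n\<close> it makes the sum over the tail
  of the series converge.
\<close>

lemma powr_le_damped:
  fixes r \<theta> x :: real
  assumes "0 < \<theta>" "\<theta> \<le> 1/2" "0 < r" "r * (1 + \<theta>) \<le> 1" "x \<ge> 1"
  shows "r powr x \<le> r * (2 * exp (-(\<theta> * x / 2)))"
proof -
  have q: "r \<le> inverse (1 + \<theta>)" using assms by (simp add: field_simps)
  have "ln (1 + \<theta>) \<ge> \<theta> - \<theta>\<^sup>2" using assms by (intro ln_one_plus_pos_lower_bound) auto
  moreover have "\<theta>\<^sup>2 \<le> \<theta> / 2" using assms by (simp add: power2_eq_square)
  ultimately have ln: "ln (1 + \<theta>) \<ge> \<theta> / 2" by linarith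
  have "r powr x = r * r powr (x - 1)"
    using assms by (simp add: powr_diff)
  also have "\<dots> \<le> r * inverse (1 + \<theta>) powr (x - 1)"
    using assms q by (intro mult_left_mono powr_mono2) auto
  also have "inverse (1 + \<theta>) powr (x - 1) = (1 + \<theta>) * exp (- (x * ln (1 + \<theta>)))"
  proof -
    have "inverse (1 + \<theta>) powr (x - 1) = exp (ln (1 + \<theta>) + (- (x * ln (1 + \<theta>))))"
      using assms by (simp add: powr_def ln_inverse algebra_simps)
    also have "\<dots> = (1 + \<theta>) * exp (- (x * ln (1 + \<theta>)))"
      unfolding exp_add using assms by simp
    finally show ?thesis .
  qed
  also have "\<dots> \<le> 2 * exp (-(\<theta> * x / 2))"
  proof (rule mult_mono)
    show "exp (- (x * ln (1 + \<theta>))) \<le> exp (-(\<theta> * x / 2))"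
      using mult_left_mono[OF ln, of x] assms by (simp add: mult.commute)
  qed (use assms in auto)
  finally show ?thesis using assms by simp
qed

lemma tail_term_bound:
  fixes X k c \<theta> x :: real
  assumes "0 < \<theta>" "\<theta> \<le> 1/2" "0 < X" "X \<le> k" "x \<ge> 1" "c \<ge> 0"
  shows "c * k powr (-x) * X powr x \<le>
    (if k \<le> X * (1 + \<theta>) then c else 0) + 2 * X * exp (-(\<theta> * x / 2)) * (c / k)"
proof -
  have k: "k > 0" using assms by linarith
  have eq: "c * k powr (-x) * X powr x = c * (X / k) powr x"
    using assms k by (simp add: powr_divide powr_minus field_simps)
  have nonneg: "0 \<le> 2 * X * exp (-(\<theta> * x / 2)) * (c / k)" using assms k by simp
  show ?thesis
  proof (cases "k \<le> X * (1 + \<theta>)")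
    case True
    have "(X / k) powr x \<le> 1" using assms k by (intro powr_le1) auto
    then have "c * (X / k) powr x \<le> c" using assms by (simp add: mult_left_le)
    then show ?thesis unfolding eq using True nonneg by simp
  next
    case False
    then have "X / k * (1 + \<theta>) \<le> 1" using k by simp
    then have "(X / k) powr x \<le> (X / k) * (2 * exp (-(\<theta> * x / 2)))"
      using powr_le_damped[of \<theta> "X / k" x] assms k by simp
    then have "c * (X / k) powr x \<le> c * ((X / k) * (2 * exp (-(\<theta> * x / 2))))"
      using assms by (intro mult_left_mono)
    then show ?thesis unfolding eq using False by (simp add: mult_ac)
  qed
qed

text \<open>
  The counterpart of \<open>dirichlet_partial_left_bound\<close> on the right, for the terms with \<open>n > N\<close>. The abscissa \<open>1\<close> leaves
  the weight \<open>1/n\<close>, which is summable against square summable coefficients.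
\<close>

lemma dirichlet_partial_tail_bound:
  assumes N: "N > 0" and \<theta>: "0 < \<theta>" "\<theta> \<le> 1/2" and E: "(\<lambda>n. cmod (d n) / Suc n) sums E"
    and G: "(\<lambda>n. d n * of_nat (Suc n) powr (-z)) sums G" and x: "Re z \<ge> 1"
  shows "cmod (G - dirichlet_partial d N z) * real N powr Re z \<le> window_sum d N \<theta> + 2 * real N * E * exp (-(\<theta> * \<bar>Re z\<bar> / 2))"
proof -
  let ?X = "real N" and ?x = "Re z"
  let ?e = "exp (-(\<theta> * \<bar>Re z\<bar> / 2))"
  define u where "u n = d n * of_nat (Suc n) powr (-z)" for n
  define v where "v n = (if n \<in> window N \<theta> then cmod (d n) else 0) + 2 * real N * ?e * (cmod (d n) / Suc n)" for n
  have vsums: "v sums (window_sum d N \<theta> + 2 * real N * ?e * E)"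
    unfolding v_def by (intro sums_add sums_mult E sums_If_finite_set finite_window)
  have le: "cmod (u (n + N)) * ?X powr ?x \<le> v (n + N)" for n
  proof -
    have n: "?X \<le> real (Suc (n + N))" by simp
    moreover have "?X * (1 - \<theta>) \<le> ?X * 1" using N \<theta> by (intro mult_left_mono) auto
    ultimately have "?X * (1 - \<theta>) \<le> real (Suc (n + N))" by linarith
    then have "n + N \<in> window N \<theta> \<longleftrightarrow> real (Suc (n + N)) \<le> ?X * (1 + \<theta>)"
      by (simp only: window_def mem_Collect_eq simp_thms)
    then show ?thesis
      using tail_term_bound[OF \<theta> _ n x, of "cmod (d (n + N))"] N x
      by (simp only: u_def v_def norm_dirichlet_term abs_of_nonneg norm_ge_zero of_nat_0_less_iff)
  qed
  have vn: "v n \<ge> 0" for n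
    unfolding v_def by (intro add_nonneg_nonneg mult_nonneg_nonneg divide_nonneg_nonneg) auto
  have vs: "summable (\<lambda>n. v (n + N))" by (intro summable_ignore_initial_segment sums_summable[OF vsums])
  have us: "(\<lambda>n. u (n + N)) sums (G - dirichlet_partial d N z)"
    unfolding u_def by (rule sums_split_initial_segment[OF G])
  have vle: "(\<Sum>n. v (n + N)) \<le> (\<Sum>n. v n)"
    using suminf_split_initial_segment[OF sums_summable[OF vsums], of N] sum_nonneg[of "{..<N}" v, OF vn]
    by linarith
  have un: "cmod (u (n + N) * of_real (?X powr ?x)) \<le> v (n + N)" for n
    using le[of n] by (simp only: norm_mult norm_of_real abs_of_nonneg powr_ge_zero)
  have "cmod ((G - dirichlet_partial d N z) * of_real (?X powr ?x)) = cmod (\<Sum>n. u (n + N) * of_real (?X powr ?x))"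
    using sums_unique[OF sums_mult2[OF us]] by metis
  also have "\<dots> \<le> (\<Sum>n. v (n + N))"
    by (rule norm_suminf_le[OF un vs])
  also have "\<dots> \<le> window_sum d N \<theta> + 2 * real N * ?e * E"
    using vle sums_unique[OF vsums] by linarith
  finally show ?thesis
    by (simp only: norm_mult norm_of_real abs_of_nonneg powr_ge_zero mult.assoc mult.commute[of E])
qed

text \<open>
  In the strip next to the imaginary axis a crude polynomial bound suffices, because the kernel
  is of order \<open>T powr -m\<close> there.
\<close>

lemma dirichlet_partial_strip_bound:
  assumes N: "N > 0" and M: "\<And>n. cmod (d n) \<le> M" and x: "0 \<le> Re z" "Re z \<le> 1"
  shows "cmod (dirichlet_partial d N z) * real N powr Re z \<le> M * N\<^sup>2"
proof -
  have M0: "M \<ge> 0" using M[of 0] norm_ge_zero order_trans by blast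
  have "cmod (dirichlet_partial d N z) \<le> (\<Sum>n<N. M)"
  proof (rule sum_norm_le)
    fix n
    have "real (Suc n) powr (- Re z) \<le> 1"
      using x by (simp add: powr_minus inverse_le_1_iff ge_one_powr_ge_zero)
    then show "cmod (d n * of_nat (Suc n) powr (-z)) \<le> M"
      unfolding norm_dirichlet_term using M[of n] M0 mult_mono[of "cmod (d n)" M "real (Suc n) powr (- Re z)" 1] by auto
  qed
  moreover have "real N powr Re z \<le> real N powr 1" using N x by (intro powr_mono) auto
  ultimately have "cmod (dirichlet_partial d N z) * real N powr Re z \<le> (N * M) * N"
    using M0 by (intro mult_mono) auto
  then show ?thesis by (simp add: power2_eq_square mult_ac)
qed

section \<open>The contour estimate for a fixed partial sum\<close>

text \<open>
  On the sides of a bracket \<open>1 / \<bar>z\<bar> \<le> 1 / T\<close>; this cancels against the length of the sides.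
\<close>

lemma norm_le_over_height:
  assumes "X > 0" "T > 0" "T \<le> cmod z" "cmod h * X powr Re z * cmod (1 + (z / of_real T)\<^sup>2) ^ m \<le> Q"
  shows "cmod (h * newman_kernel X T m z / z) \<le> Q / T"
proof -
  have "0 \<le> cmod h * X powr Re z * cmod (1 + (z / of_real T)\<^sup>2) ^ m" by simp
  then have "0 \<le> Q" using assms(4) by linarith
  have "cmod (h * newman_kernel X T m z / z) = cmod h * X powr Re z * cmod (1 + (z / of_real T)\<^sup>2) ^ m / cmod z"
    using assms by (simp add: norm_mult norm_divide norm_newman_kernel mult.assoc)
  also have "\<dots> \<le> Q / T" using assms \<open>0 \<le> Q\<close> by (intro frac_le) auto
  finally show ?thesis .
qed

lemma bracket_square:
  assumes "z \<in> bracket x T" "T > 0"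
  shows "\<bar>Re z\<bar> \<le> \<bar>x\<bar>" "\<bar>Im z\<bar> = T \<or> \<bar>Re z\<bar> = \<bar>x\<bar>" "\<bar>Im z\<bar> \<le> T"
  using bracketD[OF assms] by auto

lemma bracket_norm_ge:
  assumes "z \<in> bracket x T" "\<bar>x\<bar> = T" "T > 0"
  shows "T \<le> cmod z"
proof -
  have "\<bar>Im z\<bar> = T \<or> \<bar>Re z\<bar> = T" using bracket_square[OF assms(1)] assms by auto
  then show ?thesis using abs_Re_le_cmod[of z] abs_Im_le_cmod[of z] by auto
qed

lemma bracket_factor_power_le:
  assumes "z \<in> bracket x T" "\<bar>x\<bar> = T" "T > 0"
  shows "cmod (1 + (z / of_real T)\<^sup>2) ^ m \<le> (3 * \<bar>Re z\<bar> / T) ^ m"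
  using bracket_square[OF assms(1)] assms by (intro power_mono newman_factor_bound) auto

text \<open>
  For \<open>Re z \<ge> 1\<close> the series represents \<open>g\<close> and the difference is the tail of the series, which
  is concentrated in the window; for \<open>0 \<le> Re z < 1\<close> the two functions are bounded separately.
\<close>

lemma right_bracket_bound:
  assumes N: "N > 0" and T: "T \<ge> 1" and m: "m > 0" and \<theta>: "0 < \<theta>" "\<theta> \<le> 1/2"
    and M: "\<And>n. cmod (d n) \<le> M" and E: "(\<lambda>n. cmod (d n) / Suc n) sums E"
    and growth: "\<And>z. Re z \<ge> 0 \<Longrightarrow> cmod (g z) \<le> B * (1 + \<bar>Im z\<bar>) powr A" and A: "A \<ge> 0"
    and series: "\<And>z. Re z \<ge> 1 \<Longrightarrow> (\<lambda>n. d n * of_nat (Suc n) powr (-z)) sums g z"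
    and z: "z \<in> bracket T T"
  shows "cmod ((g z - dirichlet_partial d N z) * newman_kernel (real N) T m z / z) \<le>
     (3 ^ m * window_sum d N \<theta> + 2 * real N * E * (6 * real m / (T * \<theta>)) ^ m
       + (3 / T) ^ m * (B * (1 + T) powr A * real N + M * (real N)\<^sup>2)) / T"
proof (rule norm_le_over_height)
  let ?X = "real N" and ?x = "Re z" and ?P = "cmod (1 + (z / of_real T)\<^sup>2) ^ m"
  let ?W = "window_sum d N \<theta>"
  let ?e = "exp (-(\<theta> * ?x / 2))"
  show "real N > 0" "T > 0" using N T by auto
  show "T \<le> cmod z" using bracket_norm_ge[OF z] T by simp
  have M0: "M \<ge> 0" using M[of 0] norm_ge_zero order_trans by blast
  have E0: "E \<ge> 0" using E by (rule sums_le[OF _ sums_zero, rotated]) auto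
  have B0: "B \<ge> 0" using growth[of 0] order_trans[OF norm_ge_zero] by fastforce
  have W0: "?W \<ge> 0" by (intro sum_nonneg) auto
  have x: "0 \<le> ?x" "?x \<le> T" "\<bar>Im z\<bar> \<le> T" using bracketD[OF z] T by auto
  have P: "?P \<le> (3 * ?x / T) ^ m" using bracket_factor_power_le[OF z, of m] T x by simp
  have n1: "0 \<le> 2 * ?X * E * (6 * real m / (T * \<theta>)) ^ m" 
    using E0 T \<theta> by simp
  have n2: "0 \<le> (3 / T) ^ m * (B * (1 + T) powr A * ?X + M * ?X\<^sup>2)"
    using B0 M0 T by (intro mult_nonneg_nonneg add_nonneg_nonneg) auto
  have n3: "0 \<le> 3 ^ m * ?W" using W0 by simp
  show "cmod (g z - dirichlet_partial d N z) * ?X powr ?x * ?P \<le>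
     3 ^ m * ?W + 2 * real N * E * (6 * real m / (T * \<theta>)) ^ m
       + (3 / T) ^ m * (B * (1 + T) powr A * real N + M * (real N)\<^sup>2)"
  proof (cases "?x \<ge> 1")
    case True
    have "cmod (g z - dirichlet_partial d N z) * ?X powr ?x * ?P \<le> (?W + 2 * ?X * E * ?e) * (3 * ?x / T) ^ m"
      using dirichlet_partial_tail_bound[OF N \<theta> E series[OF True] True] True P E0 W0
      by (intro mult_mono) (auto intro!: add_nonneg_nonneg mult_nonneg_nonneg)
    also have "\<dots> = ?W * (3 * ?x / T) ^ m + 2 * ?X * E * (?e * (3 * ?x / T) ^ m)"
      by (simp only: distrib_right mult.assoc)
    also have "\<dots> \<le> ?W * 3 ^ m + 2 * ?X * E * (6 * real m / (T * \<theta>)) ^ m"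
    proof (intro add_mono mult_left_mono W0 damped_power_le power_mono)
      show "3 * ?x / T \<le> 3" using x T by (simp add: divide_le_eq)
    qed (use x T m \<theta> E0 in auto)
    finally show ?thesis using n2 by (simp add: mult.commute)
  next
    case False
    have "cmod (g z) * ?X powr ?x \<le> (B * (1 + T) powr A) * ?X powr 1"
    proof (intro mult_mono)
      have "cmod (g z) \<le> B * (1 + \<bar>Im z\<bar>) powr A" using growth x by blast
      also have "\<dots> \<le> B * (1 + T) powr A" using x A B0 by (intro mult_left_mono powr_mono2) auto
      finally show "cmod (g z) \<le> B * (1 + T) powr A" .
      show "?X powr ?x \<le> ?X powr 1" using False N by (intro powr_mono) auto
    qed (use B0 in auto)
    moreover have "cmod (dirichlet_partial d N z) * ?X powr ?x \<le> M * ?X\<^sup>2"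
      using dirichlet_partial_strip_bound[OF N M, of z] x False by simp
    moreover have "cmod (g z - dirichlet_partial d N z) * ?X powr ?x \<le> cmod (g z) * ?X powr ?x + cmod (dirichlet_partial d N z) * ?X powr ?x"
      unfolding distrib_right[symmetric] by (intro mult_right_mono norm_triangle_ineq4) auto
    ultimately have h: "cmod (g z - dirichlet_partial d N z) * ?X powr ?x \<le> B * (1 + T) powr A * ?X + M * ?X\<^sup>2" by simp
    have "(3 * ?x / T) ^ m \<le> (3 / T) ^ m" using x T False by (intro power_mono divide_right_mono) auto
    with P have "?P \<le> (3 / T) ^ m" by linarith
    with h have "cmod (g z - dirichlet_partial d N z) * ?X powr ?x * ?P \<le> (B * (1 + T) powr A * ?X + M * ?X\<^sup>2) * (3 / T) ^ m"
      using B0 M0 by (intro mult_mono) (auto intro!: add_nonneg_nonneg mult_nonneg_nonneg)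
    then show ?thesis using n1 n3 by (simp add: mult.commute)
  qed
qed

lemma left_bracket_dirichlet_partial_bound:
  assumes N: "N > 0" and T: "T \<ge> 1" and m: "m > 0" and \<theta>: "0 < \<theta>" "\<theta> \<le> 1/2"
    and M: "\<And>n. cmod (d n) \<le> M" and z: "z \<in> bracket (-T) T"
  shows "cmod (dirichlet_partial d N z * newman_kernel (real N) T m z / z) \<le>
     (3 ^ m * window_sum d N \<theta> + real N * M * (6 * real m / (T * \<theta>)) ^ m) / T"
proof (rule norm_le_over_height)
  let ?X = "real N" and ?P = "cmod (1 + (z / of_real T)\<^sup>2) ^ m"
  let ?x = "\<bar>Re z\<bar>"
  let ?W = "window_sum d N \<theta>"
  let ?e = "exp (-(\<theta> * ?x / 2))"
  show "real N > 0" "T > 0" using N T by auto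
  show "T \<le> cmod z" using bracket_norm_ge[OF z] T by simp
  have M0: "M \<ge> 0" using M[of 0] norm_ge_zero order_trans by blast
  have W0: "?W \<ge> 0" by (intro sum_nonneg) auto
  have x: "Re z \<le> 0" "0 \<le> ?x" "?x \<le> T" using bracketD[OF z] T by auto
  have P: "?P \<le> (3 * ?x / T) ^ m" using bracket_factor_power_le[OF z, of m] T by simp
  have "cmod (dirichlet_partial d N z) * ?X powr Re z * ?P \<le> (?W + ?X * M * ?e) * (3 * ?x / T) ^ m"
    using dirichlet_partial_left_bound[OF N \<theta> M x(1)] P M0 W0
    by (intro mult_mono) (auto intro!: add_nonneg_nonneg mult_nonneg_nonneg)
  also have "\<dots> = ?W * (3 * ?x / T) ^ m + ?X * M * (?e * (3 * ?x / T) ^ m)"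
    by (simp only: distrib_right mult.assoc)
  also have "\<dots> \<le> ?W * 3 ^ m + ?X * M * (6 * real m / (T * \<theta>)) ^ m"
  proof (intro add_mono mult_left_mono W0 damped_power_le power_mono)
    have "?x / T \<le> 1" using x(3) T by (subst divide_le_eq_1_pos) auto
    then show "3 * ?x / T \<le> 3" by simp
    show "0 \<le> 3 * ?x / T" using T by simp
  qed (use x T m \<theta> M0 in auto)
  finally show "cmod (dirichlet_partial d N z) * ?X powr Re z * ?P \<le> 3 ^ m * ?W + ?X * M * (6 * real m / (T * \<theta>)) ^ m"
    by (simp add: mult.commute)
qed

text \<open>
  The integral of \<open>\<bar>y\<bar> powr \<gamma> / \<bar>z\<bar>\<close> along a vertical side. It is of order \<open>T powr \<gamma>\<close>, whereas the length
  times the maximum of the integrand could be larger by a factor \<open>T\<close>.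
\<close>

lemma has_integral_powr_abs:
  assumes "\<gamma> > 0" "T > 0"
  shows "((\<lambda>y::real. (1 + \<bar>y\<bar>) powr (\<gamma> - 1)) has_integral 2 * (((1 + T) powr \<gamma> - 1) / \<gamma>)) {-T..T}"
proof -
  let ?f = "\<lambda>y::real. (1 + \<bar>y\<bar>) powr (\<gamma> - 1)"
  let ?I = "((1 + T) powr \<gamma> - 1) / \<gamma>"
  have "((\<lambda>y. (1 + y) powr (\<gamma> - 1)) has_integral ((1 + T) powr \<gamma> / \<gamma> - (1 + 0) powr \<gamma> / \<gamma>)) {0..T}"
  proof (rule fundamental_theorem_of_calculus)
    fix y assume "y \<in> {0..T}"
    then have "((\<lambda>y. (1 + y) powr \<gamma> / \<gamma>) has_real_derivative (1 + y) powr (\<gamma> - 1)) (at y within {0..T})"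
      using assms by (auto intro!: derivative_eq_intros)
    then show "((\<lambda>y. (1 + y) powr \<gamma> / \<gamma>) has_vector_derivative (1 + y) powr (\<gamma> - 1)) (at y within {0..T})"
      by (simp add: has_real_derivative_iff_has_vector_derivative)
  qed (use assms in simp)
  then have 1: "(?f has_integral ?I) {0..T}"
    by (rule has_integral_eq_rhs[OF has_integral_eq, rotated]) (auto simp: diff_divide_distrib)
  have "((\<lambda>y. ?f (-y)) has_integral ?I) {-T..0}"
    using has_integral_reflect_real[of ?f ?I T 0] 1 by simp
  then have 2: "(?f has_integral ?I) {-T..0}" by simp
  show ?thesis
    using has_integral_combine[OF _ _ 2 1] assms by simp
qed

text \<open>
  The distance \<open>b\<close> of the vertical side from the imaginary axis is fixed, so on the horizontal
  sides the kernel is \<open>O(T powr -m)\<close> and any polynomial growth of \<open>g\<close> is harmless. The second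
  summand, from the vertical side, is the one that matters.
\<close>

lemma left_bracket_bound:
  assumes cont: "continuous_on (bracket (-b) T) g" and N: "N > 0" and b: "0 < b" "b \<le> T"
    and T: "T \<ge> 1" and growth: "\<And>z. Re z \<ge> -b \<Longrightarrow> cmod (g z) \<le> B * (1 + \<bar>Im z\<bar>) powr A" and A: "A \<ge> 0"
    and line: "\<And>y. cmod (g (Complex (-b) y)) \<le> C * (1 + \<bar>y\<bar>) powr \<gamma>" and \<gamma>: "\<gamma> > 0"
  shows "cmod (bracket_integral (-b) T (\<lambda>z. g z * newman_kernel (real N) T m z / z)) \<le>
    2 * b * ((3 * b / T) ^ m * B * (1 + T) powr A / T)
     + 2 * 3 ^ m * (1 + 1 / b) * C * real N powr (-b) * (1 + T) powr \<gamma> / \<gamma>"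
proof -
  let ?F = "\<lambda>z. g z * newman_kernel (real N) T m z / z"
  let ?X = "real N"
  have B0: "B \<ge> 0" using growth[of 0] b order_trans[OF norm_ge_zero] by fastforce
  have C0: "C \<ge> 0"
  proof -
    have "0 \<le> C * (1 + \<bar>0\<bar>) powr \<gamma>" using line[of 0] norm_ge_zero order_trans by blast
    then show ?thesis by simp
  qed
  have nz: "z \<noteq> 0" if "z \<in> bracket (-b) T" for z using bracketD[OF that] T b by auto
  have cF: "continuous_on (bracket (-b) T) ?F"
    using T by (intro continuous_intros cont holomorphic_on_imp_continuous_on newman_kernel_holomorphic) (auto dest: nz)
  define H where "H = (3 * b / T) ^ m * B * (1 + T) powr A / T"
  have horiz: "cmod (contour_integral (linepath p q) ?F) \<le> H * cmod (q - p)"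
    if "closed_segment p q \<subseteq> bracket (-b) T" and im: "\<And>z. z \<in> closed_segment p q \<Longrightarrow> \<bar>Im z\<bar> = T" for p q
  proof (rule contour_integral_bound_linepath)
    show "?F contour_integrable_on linepath p q"
      using cF that by (intro contour_integrable_continuous_linepath) (auto intro: continuous_on_subset)
    show "0 \<le> H" using B0 b T by (simp add: H_def)
    fix z assume z: "z \<in> closed_segment p q"
    then have zb: "z \<in> bracket (-b) T" using that by blast
    have Im: "\<bar>Im z\<bar> = T" using im z by blast
    have Re: "-b \<le> Re z" "Re z \<le> 0" using bracketD[OF zb] T b by auto
    show "cmod (?F z) \<le> H" unfolding H_def
    proof (rule norm_le_over_height)
      show "T \<le> cmod z" using abs_Im_le_cmod[of z] Im by simp
      have "cmod (1 + (z / of_real T)\<^sup>2) \<le> 3 * \<bar>Re z\<bar> / T"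
        using Im Re b T by (intro newman_factor_bound) auto
      also have "\<dots> \<le> 3 * b / T" using Re T by (intro divide_right_mono) auto
      finally have "cmod (1 + (z / of_real T)\<^sup>2) ^ m \<le> (3 * b / T) ^ m" by (intro power_mono) auto
      moreover have "cmod (g z) \<le> B * (1 + T) powr A" using growth[of z] Re Im by simp
      moreover have "?X powr Re z \<le> 1" using Re N powr_mono[of "Re z" 0 ?X] by simp
      ultimately have "cmod (g z) * ?X powr Re z * cmod (1 + (z / of_real T)\<^sup>2) ^ m
          \<le> B * (1 + T) powr A * 1 * (3 * b / T) ^ m"
        using B0 by (intro mult_mono) auto
      then show "cmod (g z) * ?X powr Re z * cmod (1 + (z / of_real T)\<^sup>2) ^ m \<le> (3 * b / T) ^ m * B * (1 + T) powr A"
        by (simp add: mult_ac)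
    qed (use N T in auto)
  qed
  have len: "cmod (Complex (-b) (-T) - Complex 0 (-T)) = b" "cmod (Complex 0 T - Complex (-b) T) = b"
    using b by (simp_all add: cmod_def)
  have h1: "cmod (contour_integral (linepath (Complex 0 (-T)) (Complex (-b) (-T))) ?F) \<le> H * b"
    using T by (intro horiz[of "Complex 0 (-T)" "Complex (-b) (-T)", unfolded len])
      (auto simp: bracket_def dest: closed_segment_same_Im_D(1))
  have h2: "cmod (contour_integral (linepath (Complex (-b) T) (Complex 0 T)) ?F) \<le> H * b"
    using T by (intro horiz[of "Complex (-b) T" "Complex 0 T", unfolded len])
      (auto simp: bracket_def dest: closed_segment_same_Im_D(1))
  define V where "V = 3 ^ m * (1 + 1 / b) * C * ?X powr (-b)"
  have V0: "V \<ge> 0" using b C0 by (simp add: V_def)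
  have vert: "cmod (?F (Complex (-b) y)) \<le> V * (1 + \<bar>y\<bar>) powr (\<gamma> - 1)" if y: "y \<in> {-T..T}" for y
  proof -
    let ?z = "Complex (-b) y"
    have "cmod (1 + (?z / of_real T)\<^sup>2) \<le> 1 + (cmod ?z)\<^sup>2 / T\<^sup>2"
      by (rule order.trans[OF norm_triangle_ineq]) (simp add: norm_power norm_divide power_divide)
    also have "(cmod ?z)\<^sup>2 \<le> T\<^sup>2 + T\<^sup>2"
      unfolding cmod_power2 using y b by (intro add_mono) (auto simp: power2_le_iff_abs_le)
    then have "(cmod ?z)\<^sup>2 / T\<^sup>2 \<le> 2" using T by (simp add: divide_le_eq)
    finally have "cmod (1 + (?z / of_real T)\<^sup>2) ^ m \<le> 3 ^ m" by (intro power_mono) auto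
    moreover have "1 / cmod ?z \<le> (1 + 1 / b) / (1 + \<bar>y\<bar>)"
    proof -
      have "b \<le> cmod ?z" "\<bar>y\<bar> \<le> cmod ?z"
        using abs_Re_le_cmod[of ?z] abs_Im_le_cmod[of ?z] b by auto
      moreover from this have "1 \<le> 1 / b * cmod ?z" using b by (simp add: field_simps)
      ultimately have "1 + \<bar>y\<bar> \<le> (1 + 1 / b) * cmod ?z" unfolding distrib_right by linarith
      moreover have "cmod ?z > 0" using \<open>b \<le> cmod ?z\<close> b by linarith
      moreover have "1 + \<bar>y\<bar> > 0" by linarith
      ultimately show ?thesis by (simp add: divide_le_eq le_divide_eq)
    qed
    moreover have "cmod (?F ?z) = cmod (g ?z) * (?X powr (-b) * cmod (1 + (?z / of_real T)\<^sup>2) ^ m) * (1 / cmod ?z)"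
      using N by (simp add: norm_mult norm_divide norm_newman_kernel)
    ultimately have "cmod (?F ?z) \<le> (C * (1 + \<bar>y\<bar>) powr \<gamma>) * (?X powr (-b) * 3 ^ m) * ((1 + 1 / b) / (1 + \<bar>y\<bar>))"
      using line[of y] C0 by (simp only:) (intro mult_mono; auto)
    also have "\<dots> = V * (1 + \<bar>y\<bar>) powr (\<gamma> - 1)"
      by (simp add: V_def powr_diff)
    finally show ?thesis .
  qed
  have v: "cmod (contour_integral (linepath (Complex (-b) (-T)) (Complex (-b) T)) ?F) \<le> 2 * V * (1 + T) powr \<gamma> / \<gamma>"
  proof -
    have int: "(\<lambda>y. ?F (Complex (-b) y)) integrable_on {-T..T}"
    proof (rule integrable_continuous_real)
      have "Complex (-b) y \<in> bracket (-b) T" if "y \<in> {-T..T}" for y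
      proof -
        have "Complex (-b) y \<in> closed_segment (Complex (-b) (-T)) (Complex (-b) T)"
          by (subst closed_segment_same_Re) (use that T in \<open>auto simp: closed_segment_eq_real_ivl\<close>)
        then show ?thesis by (simp add: bracket_def)
      qed
      then show "continuous_on {-T..T} (\<lambda>y. ?F (Complex (-b) y))"
        by (intro continuous_on_compose2[OF cF]) (auto simp: Complex_eq intro!: continuous_intros)
    qed
    have "cmod (contour_integral (linepath (Complex (-b) (-T)) (Complex (-b) T)) ?F)
      = cmod (integral {-T..T} (\<lambda>y. ?F (Complex (-b) y)))"
      using T by (subst contour_integral_linepath_same_Re[of _ "-b" _ "-T" T]) (auto simp: norm_mult)
    also have "\<dots> \<le> integral {-T..T} (\<lambda>y. V * (1 + \<bar>y\<bar>) powr (\<gamma> - 1))"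
      using has_integral_powr_abs[OF \<gamma>, of T] T vert
      by (intro integral_norm_bound_integral int) (auto intro!: integrable_on_mult_right)
    also have "\<dots> = V * (2 * (((1 + T) powr \<gamma> - 1) / \<gamma>))"
      using has_integral_powr_abs[OF \<gamma>, of T] T by (simp add: integral_unique)
    also have "\<dots> \<le> V * (2 * ((1 + T) powr \<gamma> / \<gamma>))"
      using V0 \<gamma> by (intro mult_left_mono divide_right_mono) auto
    finally show ?thesis by (simp add: mult_ac)
  qed
  have "cmod (bracket_integral (-b) T ?F) \<le> H * b + 2 * V * (1 + T) powr \<gamma> / \<gamma> + H * b"
    unfolding bracket_integral_def by (intro norm_triangle_mono h1 h2 v)
  then show ?thesis by (simp add: H_def V_def mult_ac)
qed

text \<open>
  Cauchy's formula for \<open>g\<close> and for the Dirichlet polynomial with the same right bracket; the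
  difference of the two is estimated bracket by bracket. The polynomial is entire, so its left
  bracket may be moved out to \<open>Re z = -T\<close>, where its terms below the window are damped.
\<close>

lemma newman_inequality:
  assumes hol: "g holomorphic_on {z. - r0 < Re z}" and N: "N > 0" and m: "m > 0"
    and \<theta>: "0 < \<theta>" "\<theta> \<le> 1/2" and b: "0 < b" "b < r0" "b \<le> T" and T: "T \<ge> 1"
    and M: "\<And>n. cmod (d n) \<le> M" and E: "(\<lambda>n. cmod (d n) / Suc n) sums E"
    and growth: "\<And>z. Re z \<ge> -b \<Longrightarrow> cmod (g z) \<le> B * (1 + \<bar>Im z\<bar>) powr A" and A: "A \<ge> 0"
    and line: "\<And>y. cmod (g (Complex (-b) y)) \<le> C * (1 + \<bar>y\<bar>) powr \<gamma>" and \<gamma>: "\<gamma> > 0"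
    and series: "\<And>z. Re z \<ge> 1 \<Longrightarrow> (\<lambda>n. d n * of_nat (Suc n) powr (-z)) sums g z"
  shows "cmod (g 0 - dirichlet_partial d N 0) \<le>
     4 * (3 ^ m * window_sum d N \<theta> + 2 * real N * E * (6 * real m / (T * \<theta>)) ^ m
       + (3 / T) ^ m * (B * (1 + T) powr A * real N + M * (real N)\<^sup>2))
     + 4 * (3 ^ m * window_sum d N \<theta> + real N * M * (6 * real m / (T * \<theta>)) ^ m)
     + (2 * b * ((3 * b / T) ^ m * B * (1 + T) powr A / T)
       + 2 * 3 ^ m * (1 + 1 / b) * C * real N powr (-b) * (1 + T) powr \<gamma> / \<gamma>)"
    (is "_ \<le> 4 * ?Q1 + 4 * ?Q2 + ?Q3")
proof -
  let ?k = "newman_kernel (real N) T m" and ?S = "dirichlet_partial d N"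
  have T0: "T > 0" using T by simp
  have nz: "z \<noteq> 0" if "z \<in> bracket x T" "x \<noteq> 0" for x z
    using bracketD[OF that(1) T0] that(2) T0 by auto
  have holS: "?S holomorphic_on A" for A by (intro holomorphic_intros)
  have holk: "?k holomorphic_on A" for A using T0 by (intro newman_kernel_holomorphic) auto
  have dom: "bracket T T \<subseteq> {z. - r0 < Re z}" "bracket (-b) T \<subseteq> {z. - r0 < Re z}"
    using bracketD[OF _ T0] b T0 by fastforce+
  have cS: "continuous_on (bracket x T) (\<lambda>z. ?S z * ?k z / z)" if "x \<noteq> 0" for x
    using nz that by (intro continuous_intros holomorphic_on_imp_continuous_on holS holk) auto
  have cg: "continuous_on (bracket x T) g" if "bracket x T \<subseteq> {z. - r0 < Re z}" for x
    using holomorphic_on_imp_continuous_on[OF hol] that by (rule continuous_on_subset)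
  have cgk: "continuous_on (bracket x T) (\<lambda>z. g z * ?k z / z)" if "x \<noteq> 0" "bracket x T \<subseteq> {z. - r0 < Re z}" for x
    using nz that by (intro continuous_intros cg holomorphic_on_imp_continuous_on holk) auto
  have "2 * pi * \<i> * g 0 = bracket_integral T T (\<lambda>z. g z * ?k z / z) - bracket_integral (-b) T (\<lambda>z. g z * ?k z / z)"
    using Cauchy_two_brackets[OF holomorphic_on_mult[OF hol holk] b(1,2) T0 T0] by simp
  moreover have "2 * pi * \<i> * ?S 0 = bracket_integral T T (\<lambda>z. ?S z * ?k z / z) - bracket_integral (-T) T (\<lambda>z. ?S z * ?k z / z)"
    using Cauchy_two_brackets[OF holomorphic_on_mult[OF holS holk], of T "T + 1" T T] T0 by simp
  moreover have "bracket_integral T T (\<lambda>z. (g z - ?S z) * ?k z / z) =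
      bracket_integral T T (\<lambda>z. g z * ?k z / z) - bracket_integral T T (\<lambda>z. ?S z * ?k z / z)"
    using bracket_integral_diff[OF cgk cS] dom T0 by (simp add: left_diff_distrib diff_divide_distrib)
  ultimately have eq: "2 * pi * \<i> * (g 0 - ?S 0) =
      bracket_integral T T (\<lambda>z. (g z - ?S z) * ?k z / z) + bracket_integral (-T) T (\<lambda>z. ?S z * ?k z / z)
      - bracket_integral (-b) T (\<lambda>z. g z * ?k z / z)"
    unfolding right_diff_distrib by simp
  have nonneg: "0 \<le> Q" if "\<And>z. z \<in> bracket x T \<Longrightarrow> cmod (F z) \<le> Q / T" for Q x F
  proof -
    have "Complex 0 T \<in> bracket x T" by (simp add: bracket_def)
    then have "0 \<le> Q / T" using that norm_ge_zero order_trans by blast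
    then show ?thesis using T0 by (simp add: zero_le_divide_iff)
  qed
  have q1: "cmod ((g z - ?S z) * ?k z / z) \<le> ?Q1 / T" if "z \<in> bracket T T" for z
    using b by (intro right_bracket_bound[OF N T m \<theta> M E _ A series that] growth) auto
  have "cmod (bracket_integral T T (\<lambda>z. (g z - ?S z) * ?k z / z)) \<le> ?Q1 / T * (2 * \<bar>T\<bar> + 2 * T)"
  proof (rule bracket_integral_bound[OF _ _ T0 q1])
    show "continuous_on (bracket T T) (\<lambda>z. (g z - ?S z) * ?k z / z)"
      using nz T0 by (intro continuous_intros cg dom holomorphic_on_imp_continuous_on holS holk) auto
    show "0 \<le> ?Q1 / T" using nonneg[of T, OF q1] T0 by simp
  qed
  then have i1: "cmod (bracket_integral T T (\<lambda>z. (g z - ?S z) * ?k z / z)) \<le> 4 * ?Q1" using T0 by simp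
  have q2: "cmod (?S z * ?k z / z) \<le> ?Q2 / T" if "z \<in> bracket (-T) T" for z
    by (rule left_bracket_dirichlet_partial_bound[OF N T m \<theta> M that])
  have "cmod (bracket_integral (-T) T (\<lambda>z. ?S z * ?k z / z)) \<le> ?Q2 / T * (2 * \<bar>-T\<bar> + 2 * T)"
    using nonneg[of "-T", OF q2] T0
    by (intro bracket_integral_bound[OF _ _ T0 q2] cS) auto
  then have i2: "cmod (bracket_integral (-T) T (\<lambda>z. ?S z * ?k z / z)) \<le> 4 * ?Q2" using T0 by simp
  have i3: "cmod (bracket_integral (-b) T (\<lambda>z. g z * ?k z / z)) \<le> ?Q3"
    by (rule left_bracket_bound[OF cg[OF dom(2)] N b(1,3) T growth A line \<gamma>])
  have "1 * cmod (g 0 - ?S 0) \<le> (2 * pi) * cmod (g 0 - ?S 0)"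
    using pi_gt3 by (intro mult_right_mono) auto
  also have "\<dots> = cmod (2 * pi * \<i> * (g 0 - ?S 0))" by (simp add: norm_mult)
  also have "\<dots> \<le> 4 * ?Q1 + 4 * ?Q2 + ?Q3"
    unfolding eq by (rule order.trans[OF norm_triangle_ineq4 add_mono[OF order.trans[OF norm_triangle_ineq add_mono[OF i1 i2]] i3]])
  finally show ?thesis by (simp only: mult_1)
qed

section \<open>Convergence of the partial sums\<close>

lemma card_window_le:
  assumes "0 \<le> \<theta>"
  shows "real (card (window N \<theta>)) \<le> 2 * \<theta> * real N + 1"
proof -
  let ?lo = "real N * (1 - \<theta>)" and ?hi = "real N * (1 + \<theta>)"
  have "card (window N \<theta>) = card ((\<lambda>n. int (Suc n)) ` window N \<theta>)"
    by (rule card_image[symmetric]) (auto simp: inj_on_def)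
  also have "\<dots> \<le> card {\<lceil>?lo\<rceil>..\<lfloor>?hi\<rfloor>}"
  proof (rule card_mono)
    show "(\<lambda>n. int (Suc n)) ` window N \<theta> \<subseteq> {\<lceil>?lo\<rceil>..\<lfloor>?hi\<rfloor>}"
      by (auto simp: window_def ceiling_le_iff le_floor_iff)
  qed simp
  finally have "card (window N \<theta>) \<le> nat (\<lfloor>?hi\<rfloor> - \<lceil>?lo\<rceil> + 1)" by simp
  moreover have "real (nat (\<lfloor>?hi\<rfloor> - \<lceil>?lo\<rceil> + 1)) \<le> 2 * \<theta> * real N + 1"
  proof (cases "\<lfloor>?hi\<rfloor> - \<lceil>?lo\<rceil> + 1 \<ge> 0")
    case True
    have "real_of_int (\<lfloor>?hi\<rfloor> - \<lceil>?lo\<rceil> + 1) \<le> ?hi - ?lo + 1"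
      using of_int_floor_le[of ?hi] le_of_int_ceiling[of ?lo] unfolding of_int_add of_int_diff of_int_1
      by linarith
    then show ?thesis using True by (simp add: algebra_simps)
  qed (use assms in simp)
  ultimately show ?thesis by linarith
qed

text \<open>
  Cauchy-Schwarz on the window. The condition \<open>N\<theta> \<ge> 1\<close> absorbs the \<open>1\<close> in the bound for the
  number of its elements.
\<close>

lemma window_sum_bound:
  assumes L: "(\<lambda>n. (cmod (c n))\<^sup>2) sums L" and \<sigma>: "\<sigma> \<ge> 0"
    and d: "\<And>n. cmod (d n) = cmod (c n) * real (Suc n) powr (-\<sigma>)"
    and N: "N > 0" and \<theta>: "0 < \<theta>" "\<theta> \<le> 1/2" "real N * \<theta> \<ge> 1"
  shows "window_sum d N \<theta> \<le> 2 powr \<sigma> * sqrt (3 * L) * (real N powr (-\<sigma>) * sqrt (real N * \<theta>))"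
proof -
  let ?W = "window N \<theta>"
  have "window_sum d N \<theta> \<le> (\<Sum>n\<in>?W. cmod (c n) * (real N / 2) powr (-\<sigma>))"
  proof (rule sum_mono)
    fix n assume "n \<in> ?W"
    then have "real N * (1 - \<theta>) \<le> real (Suc n)" by (simp add: window_def)
    moreover have "real N * (1 / 2) \<le> real N * (1 - \<theta>)" using \<theta> by (intro mult_left_mono) auto
    ultimately have "real N / 2 \<le> real (Suc n)" by linarith
    then show "cmod (d n) \<le> cmod (c n) * (real N / 2) powr (-\<sigma>)"
      unfolding d using N \<sigma> by (intro mult_left_mono powr_mono2') auto
  qed
  also have "\<dots> = (real N / 2) powr (-\<sigma>) * (\<Sum>n\<in>?W. cmod (c n))"
    by (simp add: sum_distrib_right mult.commute)
  also have "(\<Sum>n\<in>?W. cmod (c n)) \<le> sqrt (L * (3 * (real N * \<theta>)))"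
  proof (rule real_le_rsqrt)
    have "(\<Sum>n\<in>?W. cmod (c n))\<^sup>2 \<le> (\<Sum>n\<in>?W. (cmod (c n))\<^sup>2) * card ?W"
      by (rule sum_squared_le_sum_of_squares)
    also have "\<dots> \<le> L * (3 * (real N * \<theta>))"
    proof (rule mult_mono)
      show "(\<Sum>n\<in>?W. (cmod (c n))\<^sup>2) \<le> L"
        using sum_le_suminf[OF sums_summable[OF L] finite_window[of N \<theta>]] sums_unique[OF L] by simp
      show "real (card ?W) \<le> 3 * (real N * \<theta>)"
        using card_window_le[of \<theta> N] \<theta> by (simp add: algebra_simps)
      show "L \<ge> 0" using L by (rule sums_le[OF _ sums_zero, rotated]) auto
    qed simp
    finally show "(\<Sum>n\<in>?W. cmod (c n))\<^sup>2 \<le> L * (3 * (real N * \<theta>))" .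
  qed
  also have "(real N / 2) powr (-\<sigma>) * sqrt (L * (3 * (real N * \<theta>)))
      = 2 powr \<sigma> * sqrt (3 * L) * (real N powr (-\<sigma>) * sqrt (real N * \<theta>))"
    using N by (simp add: powr_divide powr_minus_divide real_sqrt_mult)
  finally show ?thesis by (simp add: mult_left_mono)
qed

text \<open>
  The choice of parameters is \<open>T = N powr \<alpha>\<close> and \<open>T\<theta> = N powr (\<alpha>\<eta>)\<close>. With \<open>m\<close> large, all terms of
  \<open>newman_inequality\<close> other than the window sum and the vertical side are \<open>O(1/N)\<close>.
\<close>

lemma dirichlet_partial_tendsto:
  assumes hol: "g holomorphic_on {z. - r0 < Re z}" and b: "0 < b" "b < r0"
    and M: "\<And>n. cmod (d n) \<le> M" and E: "(\<lambda>n. cmod (d n) / Suc n) sums E"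
    and growth: "\<And>z. Re z \<ge> -b \<Longrightarrow> cmod (g z) \<le> B * (1 + \<bar>Im z\<bar>) powr A" and A: "A \<ge> 0"
    and line: "\<And>y. cmod (g (Complex (-b) y)) \<le> C * (1 + \<bar>y\<bar>) powr \<gamma>" and \<gamma>: "\<gamma> > 0"
    and series: "\<And>z. Re z \<ge> 1 \<Longrightarrow> (\<lambda>n. d n * of_nat (Suc n) powr (-z)) sums g z"
    and \<alpha>: "0 < \<alpha>" "\<alpha> * \<gamma> < b" and \<eta>: "0 < \<eta>" "\<eta> < 1" and p: "p < 0"
    and W: "\<forall>\<^sub>F N in sequentially. window_sum d N (real N powr (- (\<alpha> * (1 - \<eta>)))) \<le> K * real N powr p"
  shows "(\<lambda>N. dirichlet_partial d N 0) \<longlonglongrightarrow> g 0"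
proof -
  have M0: "M \<ge> 0" using M[of 0] norm_ge_zero order_trans by blast
  have E0: "E \<ge> 0" using E by (rule sums_le[OF _ sums_zero, rotated]) auto
  have B0: "B \<ge> 0" using growth[of 0] b order_trans[OF norm_ge_zero] by fastforce
  have C0: "C \<ge> 0"
  proof -
    have "0 \<le> C * (1 + \<bar>0\<bar>) powr \<gamma>" using line[of 0] norm_ge_zero order_trans by blast
    then show ?thesis by simp
  qed
  \<comment> \<open>The \<open>3\<close> beats the factor \<open>N\<^sup>2\<close> of the strip bound, \<open>\<alpha> A\<close> the growth \<open>T powr A\<close> of \<open>g\<close>.\<close>
  obtain m :: nat where m': "(3 + \<alpha> * A) / (\<alpha> * \<eta>) < m" using reals_Archimedean2 by blast
  then have m1: "3 + \<alpha> * A < \<alpha> * \<eta> * m" using \<alpha> \<eta> by (simp add: field_simps)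
  have \<alpha>A: "0 \<le> \<alpha> * A" using \<alpha> A by simp
  have m: "m > 0" using m1 \<alpha>A by (cases m) auto
  have "\<alpha> * m * \<eta> \<le> \<alpha> * m * 1" using \<alpha> \<eta> by (intro mult_left_mono) auto
  then have m2: "3 + \<alpha> * A < \<alpha> * m" using m1 by (simp add: mult_ac)
  \<comment> \<open>A common exponent for all terms.\<close>
  define e where "e = max (-1) (max p (\<alpha> * \<gamma> - b))"
  have e: "e < 0" "-1 \<le> e" "p \<le> e" "\<alpha> * \<gamma> - b \<le> e" using p \<alpha> by (auto simp: e_def)
  define Q where "Q = 4 * (3 ^ m * \<bar>K\<bar> + 2 * E * (6 * real m) ^ m + 3 ^ m * (B * 2 powr A + M))
     + 4 * (3 ^ m * \<bar>K\<bar> + M * (6 * real m) ^ m)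
     + (2 * b * ((3 * b) ^ m * B * 2 powr A) + 2 * 3 ^ m * (1 + 1 / b) * C * 2 powr \<gamma> / \<gamma>)"
  have ev1: "\<forall>\<^sub>F N in sequentially. real N powr \<alpha> \<ge> max 1 b"
  proof -
    have "filterlim (\<lambda>N. real N powr \<alpha>) at_top sequentially"
      by (rule filterlim_compose[OF real_powr_at_top filterlim_real_sequentially]) (use \<alpha> in simp)
    then show ?thesis unfolding filterlim_at_top by blast
  qed
  have ev2: "\<forall>\<^sub>F N in sequentially. real N powr (- (\<alpha> * (1 - \<eta>))) < 1/2"
  proof -
    have "(\<lambda>N. real N powr (- (\<alpha> * (1 - \<eta>)))) \<longlonglongrightarrow> 0"
      by (rule tendsto_neg_powr[OF _ filterlim_real_sequentially]) (use \<alpha> \<eta> in simp)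
    then show ?thesis by (rule order_tendstoD) simp
  qed
  have "\<forall>\<^sub>F N in sequentially. cmod (dirichlet_partial d N 0 - g 0) \<le> Q * real N powr e"
    using W ev1 ev2 eventually_gt_at_top[of 0]
  proof eventually_elim
    case (elim N)
    define X where "X = real N"
    define T where "T = X powr \<alpha>"
    define \<theta> where "\<theta> = X powr (- (\<alpha> * (1 - \<eta>)))"
    have X1: "X \<ge> 1" using elim by (simp add: X_def)
    have T: "T \<ge> 1" "b \<le> T" using elim by (auto simp: T_def X_def)
    have \<theta>: "0 < \<theta>" "\<theta> \<le> 1/2" using elim X1 by (auto simp: \<theta>_def X_def)
    have le_e: "X powr q \<le> X powr e" if "q \<le> e" for q using that X1 by (intro powr_mono) auto
    have Tpow: "T ^ m = X powr (\<alpha> * m)" using X1 by (simp add: T_def powr_powr powr_realpow[symmetric])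
    have T\<theta>: "T * \<theta> = X powr (\<alpha> * \<eta>)" by (simp add: T_def \<theta>_def powr_add[symmetric] algebra_simps)
    have dampeq: "(6 * real m / (T * \<theta>)) ^ m = (6 * real m) ^ m * X powr (- (\<alpha> * \<eta> * m))"
      using X1 unfolding T\<theta> by (simp add: power_divide powr_powr powr_realpow[symmetric] powr_minus_divide)
    have damp: "X * (6 * real m / (T * \<theta>)) ^ m \<le> (6 * real m) ^ m * X powr e"
    proof -
      have "X * (6 * real m / (T * \<theta>)) ^ m = (6 * real m) ^ m * X powr (1 - \<alpha> * \<eta> * m)"
        using X1 unfolding dampeq by (simp add: powr_diff powr_minus_divide)
      also have "\<dots> \<le> (6 * real m) ^ m * X powr e"
        using m1 \<alpha>A e by (intro mult_left_mono le_e) auto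
      finally show ?thesis .
    qed
    have powT: "(1 + T) powr q \<le> 2 powr q * X powr (\<alpha> * q)" if "q \<ge> 0" for q
    proof -
      have "(1 + T) powr q \<le> (2 * T) powr q" using T that by (intro powr_mono2) auto
      then show ?thesis using X1 by (simp add: T_def powr_mult powr_powr)
    qed
    have w: "window_sum d N \<theta> \<le> \<bar>K\<bar> * X powr e"
    proof -
      have "window_sum d N \<theta> \<le> K * X powr p" using elim by (simp add: \<theta>_def X_def)
      also have "\<dots> \<le> \<bar>K\<bar> * X powr e" using le_e e by (intro mult_mono) auto
      finally show ?thesis .
    qed
    have t3: "(3 / T) ^ m * (B * (1 + T) powr A * X + M * X\<^sup>2) \<le> 3 ^ m * (B * 2 powr A + M) * X powr e"
    proof -
      have "(3 / T) ^ m * (B * (1 + T) powr A * X + M * X\<^sup>2)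
          \<le> (3 / T) ^ m * (B * (2 powr A * X powr (\<alpha> * A)) * X + M * X\<^sup>2)"
        using T X1 B0 by (intro mult_left_mono add_right_mono mult_right_mono powT A) auto
      also have "\<dots> = 3 ^ m * (B * 2 powr A * X powr (\<alpha> * A + 1 - \<alpha> * m) + M * X powr (2 - \<alpha> * m))"
        using X1 by (simp add: power_divide Tpow powr_diff powr_add field_simps)
      also have "\<dots> \<le> 3 ^ m * (B * 2 powr A * X powr e + M * X powr e)"
        using m2 \<alpha>A e B0 M0 by (intro mult_left_mono add_mono le_e) auto
      finally show ?thesis by (simp add: algebra_simps)
    qed
    have t6: "(3 * b / T) ^ m * B * (1 + T) powr A / T \<le> (3 * b) ^ m * B * 2 powr A * X powr e"
    proof -
      have "(3 * b / T) ^ m * B * (1 + T) powr A / T \<le> (3 * b / T) ^ m * B * (1 + T) powr A / 1"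
        using T b B0 by (intro divide_left_mono) auto
      also have "\<dots> \<le> (3 * b / T) ^ m * B * (2 powr A * X powr (\<alpha> * A)) / 1"
        using T b B0 by (intro divide_right_mono mult_left_mono powT A) auto
      also have "\<dots> = (3 * b) ^ m * B * 2 powr A * X powr (\<alpha> * A - \<alpha> * m)"
        using X1 by (simp add: power_divide Tpow powr_diff field_simps)
      also have "\<dots> \<le> (3 * b) ^ m * B * 2 powr A * X powr e"
        using m2 \<alpha>A e B0 b by (intro mult_left_mono le_e) auto
      finally show ?thesis .
    qed
    have t7: "2 * 3 ^ m * (1 + 1 / b) * C * X powr (-b) * (1 + T) powr \<gamma> / \<gamma>
        \<le> 2 * 3 ^ m * (1 + 1 / b) * C * 2 powr \<gamma> / \<gamma> * X powr e"
    proof -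
      have "2 * 3 ^ m * (1 + 1 / b) * C * X powr (-b) * (1 + T) powr \<gamma> / \<gamma>
          \<le> 2 * 3 ^ m * (1 + 1 / b) * C * X powr (-b) * (2 powr \<gamma> * X powr (\<alpha> * \<gamma>)) / \<gamma>"
        using b C0 \<gamma> by (intro divide_right_mono mult_left_mono powT) auto
      also have "\<dots> = 2 * 3 ^ m * (1 + 1 / b) * C * 2 powr \<gamma> / \<gamma> * X powr (\<alpha> * \<gamma> - b)"
        by (simp add: powr_diff powr_minus_divide mult_ac)
      also have "\<dots> \<le> 2 * 3 ^ m * (1 + 1 / b) * C * 2 powr \<gamma> / \<gamma> * X powr e"
        using b C0 \<gamma> e by (intro mult_left_mono le_e) auto
      finally show ?thesis .
    qed
    have "cmod (dirichlet_partial d N 0 - g 0) = cmod (g 0 - dirichlet_partial d N 0)" by (rule norm_minus_commute)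
    also have "\<dots> \<le> 4 * (3 ^ m * window_sum d N \<theta> + 2 * X * E * (6 * real m / (T * \<theta>)) ^ m
       + (3 / T) ^ m * (B * (1 + T) powr A * X + M * X\<^sup>2))
     + 4 * (3 ^ m * window_sum d N \<theta> + X * M * (6 * real m / (T * \<theta>)) ^ m)
     + (2 * b * ((3 * b / T) ^ m * B * (1 + T) powr A / T)
       + 2 * 3 ^ m * (1 + 1 / b) * C * X powr (-b) * (1 + T) powr \<gamma> / \<gamma>)"
      unfolding X_def using elim T
      by (intro newman_inequality[OF hol _ m \<theta> b _ _ M E growth A line \<gamma> series]) auto
    also have "\<dots> \<le> 4 * (3 ^ m * (\<bar>K\<bar> * X powr e) + 2 * E * ((6 * real m) ^ m * X powr e)
       + 3 ^ m * (B * 2 powr A + M) * X powr e)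
     + 4 * (3 ^ m * (\<bar>K\<bar> * X powr e) + M * ((6 * real m) ^ m * X powr e))
     + (2 * b * ((3 * b) ^ m * B * 2 powr A * X powr e)
       + 2 * 3 ^ m * (1 + 1 / b) * C * 2 powr \<gamma> / \<gamma> * X powr e)"
    proof -
      have "2 * X * E * (6 * real m / (T * \<theta>)) ^ m \<le> 2 * E * ((6 * real m) ^ m * X powr e)"
        using mult_left_mono[OF damp, of "2 * E"] E0 by (simp only: mult_ac)
      moreover have "X * M * (6 * real m / (T * \<theta>)) ^ m \<le> M * ((6 * real m) ^ m * X powr e)"
        using mult_left_mono[OF damp, of M] M0 by (simp only: mult_ac)
      ultimately show ?thesis
        using b by (intro add_mono mult_left_mono w t3 t6 t7) auto
    qed
    also have "\<dots> = Q * X powr e"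
      by (simp only: Q_def distrib_right mult.assoc distrib_left)
    finally show ?case unfolding X_def .
  qed
  moreover have "(\<lambda>N. Q * real N powr e) \<longlonglongrightarrow> 0"
    using tendsto_mult_left[OF tendsto_neg_powr[OF e(1) filterlim_real_sequentially], of Q] by simp
  ultimately have "(\<lambda>N. dirichlet_partial d N 0 - g 0) \<longlonglongrightarrow> 0" by (rule Lim_null_comparison)
  then show ?thesis by (rule LIM_zero_cancel)
qed

section \<open>Bounds for the function and its coefficients\<close>

text \<open>
  The limit superior controls large \<open>\<bar>t\<bar>\<close> in both directions, and continuity controls the
  remaining compact interval.
\<close>

lemma lindelof_mu_less_imp_bound:
  assumes cont: "continuous_on UNIV (\<lambda>t. f (Complex \<sigma> t))"
    and mu: "lindelof_mu f \<sigma> < ereal \<gamma>" and \<gamma>: "\<gamma> \<ge> 0"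
  obtains C where "\<And>t. cmod (f (Complex \<sigma> t)) \<le> C * (1 + \<bar>t\<bar>) powr \<gamma>" "C \<ge> 0"
proof -
  have "\<forall>\<^sub>F t in at_infinity. log_ext (cmod (f (Complex \<sigma> t))) / ereal (ln \<bar>t\<bar>) < ereal \<gamma>"
    using mu unfolding lindelof_mu_def by (rule Limsup_lessD)
  then obtain R where R: "\<And>t. R \<le> \<bar>t\<bar> \<Longrightarrow> log_ext (cmod (f (Complex \<sigma> t))) / ereal (ln \<bar>t\<bar>) < ereal \<gamma>"
    unfolding eventually_at_infinity by auto
  define R' where "R' = max R 2"
  have "compact ((\<lambda>t. f (Complex \<sigma> t)) ` {-R'..R'})"
    by (intro compact_continuous_image continuous_on_subset[OF cont]) auto
  then obtain C0 where C0: "\<And>t. t \<in> {-R'..R'} \<Longrightarrow> cmod (f (Complex \<sigma> t)) \<le> C0"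
    by (metis (mono_tags, lifting) bounded_iff compact_imp_bounded imageI)
  have "cmod (f (Complex \<sigma> t)) \<le> max 1 C0 * (1 + \<bar>t\<bar>) powr \<gamma>" for t
  proof (cases "\<bar>t\<bar> \<le> R'")
    case True
    then have "cmod (f (Complex \<sigma> t)) \<le> C0" by (intro C0) auto
    also have "\<dots> \<le> max 1 C0 * 1" by simp
    also have "\<dots> \<le> max 1 C0 * (1 + \<bar>t\<bar>) powr \<gamma>"
      using \<gamma> by (intro mult_left_mono ge_one_powr_ge_zero) auto
    finally show ?thesis .
  next
    case False
    then have t: "\<bar>t\<bar> > 2" "R \<le> \<bar>t\<bar>" by (auto simp: R'_def)
    show ?thesis
    proof (cases "f (Complex \<sigma> t) = 0")
      case True
      then show ?thesis by simp
    next
      case nz: False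
      have ln: "ln \<bar>t\<bar> > 0" using t by simp
      have "ln (cmod (f (Complex \<sigma> t))) / ln \<bar>t\<bar> < \<gamma>"
        using R[OF t(2)] nz ln by (simp add: log_ext_def)
      then have "ln (cmod (f (Complex \<sigma> t))) < \<gamma> * ln \<bar>t\<bar>" using ln by (simp add: field_simps)
      then have "exp (ln (cmod (f (Complex \<sigma> t)))) < exp (\<gamma> * ln \<bar>t\<bar>)" by (simp only: exp_less_cancel_iff)
      then have "cmod (f (Complex \<sigma> t)) \<le> \<bar>t\<bar> powr \<gamma>" using nz t by (simp add: powr_def)
      also have "\<dots> \<le> 1 * (1 + \<bar>t\<bar>) powr \<gamma>" using \<gamma> by (simp add: powr_mono2)
      also have "\<dots> \<le> max 1 C0 * (1 + \<bar>t\<bar>) powr \<gamma>" by (intro mult_right_mono) auto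
      finally show ?thesis .
    qed
  qed
  then show ?thesis by (rule that) simp
qed

text \<open>
  Translation by \<open>i Im s\<close> costs only a constant factor in polynomial bounds.
\<close>

lemma shifted_powr_le:
  fixes u v q :: real
  assumes "q \<ge> 0"
  shows "(1 + \<bar>u + v\<bar>) powr q \<le> (1 + \<bar>u\<bar>) powr q * (1 + \<bar>v\<bar>) powr q"
proof -
  have "1 + \<bar>u + v\<bar> \<le> (1 + \<bar>u\<bar>) * (1 + \<bar>v\<bar>)"
    using abs_triangle_ineq[of u v] mult_nonneg_nonneg[of "\<bar>u\<bar>" "\<bar>v\<bar>"]
    unfolding distrib_left distrib_right by linarith
  then have "(1 + \<bar>u + v\<bar>) powr q \<le> ((1 + \<bar>u\<bar>) * (1 + \<bar>v\<bar>)) powr q"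
    using assms by (intro powr_mono2) auto
  then show ?thesis by (simp add: powr_mult)
qed

lemma finite_order_bound:
  assumes "finite_order 0 f" "\<epsilon> > 0"
  obtains A B where "A \<ge> 0" "B \<ge> 0" "\<And>w. Re w \<ge> \<epsilon> \<Longrightarrow> cmod (f w) \<le> B * (1 + \<bar>Im w\<bar>) powr A"
proof -
  obtain A B where AB: "\<And>\<sigma> t. \<epsilon> \<le> \<sigma> \<Longrightarrow> cmod (f (Complex \<sigma> t)) \<le> B * (1 + \<bar>t\<bar>) powr A"
    using assms unfolding finite_order_def by fastforce
  have "cmod (f w) \<le> max 0 B * (1 + \<bar>Im w\<bar>) powr max 0 A" if "Re w \<ge> \<epsilon>" for w
  proof -
    have "cmod (f w) \<le> B * (1 + \<bar>Im w\<bar>) powr A" using AB[OF that, of "Im w"] by simp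
    also have "\<dots> \<le> max 0 B * (1 + \<bar>Im w\<bar>) powr max 0 A"
      by (intro mult_mono powr_mono) auto
    finally show ?thesis .
  qed
  then show ?thesis by (intro that[of "max 0 A" "max 0 B"]) auto
qed

lemma norm_le_sqrt_sum_squares:
  assumes L: "(\<lambda>n. (cmod (c n))\<^sup>2) sums L"
  shows "cmod (c n) \<le> sqrt L"
proof (rule real_le_rsqrt)
  have "(\<Sum>i\<in>{n}. (cmod (c i))\<^sup>2) \<le> (\<Sum>i. (cmod (c i))\<^sup>2)"
    by (intro sum_le_suminf sums_summable[OF L]) auto
  then show "(cmod (c n))\<^sup>2 \<le> L" using sums_unique[OF L] by simp
qed

lemma summable_div_Suc:
  assumes "summable (\<lambda>n. (cmod (c n))\<^sup>2)"
  shows "summable (\<lambda>n. cmod (c n) / Suc n)"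
proof (rule summable_comparison_test')
  have "summable (\<lambda>n. inverse (real (Suc n) ^ 2))"
    by (subst summable_Suc_iff) (use inverse_power_summable[of 2, where 'a=real] in simp)
  then show "summable (\<lambda>n. (cmod (c n))\<^sup>2 + inverse (real (Suc n) ^ 2))" by (intro summable_add assms)
  fix n :: nat
  let ?x = "cmod (c n)" and ?y = "inverse (real (Suc n))"
  have "0 \<le> (?x - ?y)\<^sup>2" by simp
  then have "2 * (?x * ?y) \<le> ?x\<^sup>2 + ?y\<^sup>2" by (simp add: power2_diff)
  moreover have "0 \<le> ?x * ?y" by simp
  ultimately have "?x * ?y \<le> ?x\<^sup>2 + ?y\<^sup>2" by linarith
  then show "norm (?x / Suc n) \<le> ?x\<^sup>2 + inverse (real (Suc n) ^ 2)"
    by (simp add: divide_inverse power_inverse)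
qed

lemma half_plane_shift_holomorphic:
  assumes "f analytic_on half_plane 0"
  shows "(\<lambda>z. f (s + z)) holomorphic_on {z. - Re s < Re z}"
proof -
  have "f \<circ> (\<lambda>z. s + z) holomorphic_on {z. - Re s < Re z}"
    by (rule holomorphic_on_compose_gen[OF _ analytic_imp_holomorphic[OF assms]])
       (auto intro!: holomorphic_intros simp: half_plane_def)
  then show ?thesis by (simp add: o_def)
qed

section \<open>The abscissa of convergence\<close>

text \<open>
  With \<open>\<alpha> = 1 / (1 + 2\<beta>)\<close> the identity \<open>(1 - \<alpha>) / 2 = \<alpha>\<beta>\<close> makes the window exponent
  \<open>(1 - \<alpha>) / 2 - \<sigma>\<close> and the vertical side exponent \<open>\<alpha>\<beta> - \<sigma>\<close> agree. Both are negative, with a gap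
  \<open>\<sigma> - \<alpha>\<beta>\<close> that is shared out among the losses \<open>\<epsilon>\<close> and \<open>\<eta>\<close>.
\<close>

lemma dirichlet_converges_beyond:
  assumes \<beta>: "\<beta> > 0" and a: "a \<in> hardy_H2"
    and f: "analytic_continuation_to a 0 f" and fo: "finite_order 0 f"
    and mu: "\<And>\<sigma>. \<sigma> > 0 \<Longrightarrow> lindelof_mu f \<sigma> \<le> ereal \<beta>"
    and s: "Re s > \<beta> / (1 + 2 * \<beta>)"
  shows "dirichlet_converges a s"
proof -
  define \<sigma> where "\<sigma> = Re s"
  define \<alpha> where "\<alpha> = 1 / (1 + 2 * \<beta>)"
  have \<alpha>: "0 < \<alpha>" "\<alpha> < 1" using \<beta> by (auto simp: \<alpha>_def)
  have \<alpha>\<beta>: "\<alpha> * \<beta> < \<sigma>" using s by (simp add: \<alpha>_def \<sigma>_def)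
  have half: "1 - \<alpha> = 2 * (\<alpha> * \<beta>)" using \<beta> by (simp add: \<alpha>_def field_simps)
  have "0 < \<alpha> * \<beta>" using \<alpha> \<beta> by simp
  then have \<sigma>0: "\<sigma> > 0" using \<alpha>\<beta> by linarith
  \<comment> \<open>The growth bound for \<open>f\<close> is used on the line \<open>Re w = \<epsilon>\<close>, with exponent \<open>\<beta> + \<epsilon>\<close>.\<close>
  define \<epsilon> where "\<epsilon> = (\<sigma> - \<alpha> * \<beta>) / 4"
  define b where "b = \<sigma> - \<epsilon>"
  define \<gamma> where "\<gamma> = \<beta> + \<epsilon>"
  define \<eta> where "\<eta> = min (1/2) (\<sigma> - \<alpha> * \<beta>)"
  have \<epsilon>: "\<epsilon> > 0" using \<alpha>\<beta> by (simp add: \<epsilon>_def)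
  have \<alpha>\<epsilon>: "\<alpha> * \<epsilon> \<le> \<epsilon>" using \<alpha> \<epsilon> by simp
  have b: "0 < b" "b < \<sigma>" using \<epsilon> \<alpha>\<beta> \<open>0 < \<alpha> * \<beta>\<close> by (auto simp: b_def \<epsilon>_def field_simps)
  have \<gamma>: "\<gamma> > 0" using \<beta> \<epsilon> by (simp add: \<gamma>_def)
  have \<alpha>\<gamma>: "\<alpha> * \<gamma> < b" 
  proof -
    have "\<sigma> = \<alpha> * \<beta> + 4 * \<epsilon>" by (simp add: \<epsilon>_def field_simps)
    then show ?thesis using \<alpha>\<epsilon> \<epsilon> unfolding \<gamma>_def b_def distrib_left by linarith
  qed
  have \<eta>: "0 < \<eta>" "\<eta> < 1" "\<eta> \<le> \<sigma> - \<alpha> * \<beta>" using \<alpha>\<beta> by (auto simp: \<eta>_def)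

  define c where "c n = a (Suc n)" for n
  define d where "d n = c n * of_nat (Suc n) powr (-s)" for n
  define g where "g z = f (s + z)" for z
  have sq: "summable (\<lambda>n. (cmod (c n))\<^sup>2)" using a by (simp add: hardy_H2_def c_def)
  then obtain L where L: "(\<lambda>n. (cmod (c n))\<^sup>2) sums L" by blast
  have norm_d: "cmod (d n) = cmod (c n) * real (Suc n) powr (-\<sigma>)" for n
    unfolding d_def \<sigma>_def by (rule norm_dirichlet_term)
  have d_le_c: "cmod (d n) \<le> cmod (c n)" for n
  proof -
    have "real (Suc n) powr (-\<sigma>) \<le> 1"
      using \<sigma>0 by (simp add: powr_minus inverse_le_1_iff ge_one_powr_ge_zero)
    then show ?thesis unfolding norm_d by (simp add: mult_left_le)
  qed
  have M: "cmod (d n) \<le> sqrt L" for n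
    using d_le_c[of n] norm_le_sqrt_sum_squares[OF L, of n] by linarith
  have sE: "summable (\<lambda>n. cmod (d n) / Suc n)"
    by (rule summable_comparison_test'[OF summable_div_Suc[OF sq]])
       (use d_le_c in \<open>auto intro!: divide_right_mono simp del: of_nat_Suc\<close>)
  then obtain E where E: "(\<lambda>n. cmod (d n) / Suc n) sums E" by blast
  have term_eq: "dirichlet_term a (s + z) n = d n * of_nat (Suc n) powr (-z)" for z n
    unfolding dirichlet_term_def d_def c_def
    by (simp add: powr_def exp_add[symmetric] algebra_simps del: of_nat_Suc)
  have hol: "g holomorphic_on {z. - \<sigma> < Re z}"
    using half_plane_shift_holomorphic[of f s] f unfolding analytic_continuation_to_def g_def \<sigma>_def by simp
  have series: "(\<lambda>n. d n * of_nat (Suc n) powr (-z)) sums g z" if z: "Re z \<ge> 1" for z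
  proof -
    have "summable (\<lambda>n. d n * of_nat (Suc n) powr (-z))"
    proof (rule summable_comparison_test'[OF sE])
      fix n
      have "real (Suc n) powr (- Re z) \<le> real (Suc n) powr (-1)" using z by (intro powr_mono) auto
      also have "\<dots> = 1 / real (Suc n)" by (simp add: powr_minus_divide del: of_nat_Suc)
      finally show "cmod (d n * of_nat (Suc n) powr (-z)) \<le> cmod (d n) / Suc n"
        unfolding norm_dirichlet_term using mult_left_mono[of _ "1 / real (Suc n)" "cmod (d n)"] by simp
    qed
    moreover have "f (s + z) = dirichlet_sum a (s + z)" if "dirichlet_converges a (s + z)"
      using f that z \<sigma>0 unfolding analytic_continuation_to_def half_plane_def \<sigma>_def by auto
    moreover have "dirichlet_term a (s + z) = (\<lambda>n. d n * of_nat (Suc n) powr (-z))"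
      using term_eq by blast
    ultimately show ?thesis
      unfolding dirichlet_converges_def dirichlet_sum_def g_def by (simp only: sums_iff simp_thms)
  qed
  obtain A B where A: "A \<ge> 0" and B: "B \<ge> 0"
    and AB: "\<And>w. Re w \<ge> \<epsilon> \<Longrightarrow> cmod (f w) \<le> B * (1 + \<bar>Im w\<bar>) powr A"
    using finite_order_bound[OF fo \<epsilon>] by blast
  have growth: "cmod (g z) \<le> (B * (1 + \<bar>Im s\<bar>) powr A) * (1 + \<bar>Im z\<bar>) powr A" if "Re z \<ge> -b" for z
  proof -
    have "cmod (g z) \<le> B * (1 + \<bar>Im s + Im z\<bar>) powr A"
      using AB[of "s + z"] that by (simp add: g_def b_def \<sigma>_def)
    also have "\<dots> \<le> B * ((1 + \<bar>Im s\<bar>) powr A * (1 + \<bar>Im z\<bar>) powr A)"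
      by (intro mult_left_mono shifted_powr_le A B)
    finally show ?thesis by (simp add: mult.assoc)
  qed
  have cont: "continuous_on UNIV (\<lambda>t. f (Complex \<epsilon> t))"
  proof (rule continuous_on_compose2[of "half_plane 0" f])
    show "continuous_on (half_plane 0) f"
      using f by (auto simp: analytic_continuation_to_def intro: analytic_imp_holomorphic holomorphic_on_imp_continuous_on)
    show "continuous_on UNIV (\<lambda>t. Complex \<epsilon> t)" by (auto simp: Complex_eq intro!: continuous_intros)
  qed (use \<epsilon> in \<open>auto simp: half_plane_def\<close>)
  have "ereal \<beta> < ereal \<gamma>" using \<epsilon> by (simp add: \<gamma>_def)
  with mu[OF \<epsilon>] have "lindelof_mu f \<epsilon> < ereal \<gamma>" by (rule le_less_trans)
  then obtain C where C: "\<And>t. cmod (f (Complex \<epsilon> t)) \<le> C * (1 + \<bar>t\<bar>) powr \<gamma>" "C \<ge> 0"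
    using lindelof_mu_less_imp_bound[OF cont] \<gamma> by (metis less_imp_le)
  have line: "cmod (g (Complex (-b) y)) \<le> (C * (1 + \<bar>Im s\<bar>) powr \<gamma>) * (1 + \<bar>y\<bar>) powr \<gamma>" for y
  proof -
    have "s + Complex (-b) y = Complex \<epsilon> (Im s + y)" by (simp add: complex_eq_iff b_def \<sigma>_def)
    then have "cmod (g (Complex (-b) y)) \<le> C * (1 + \<bar>Im s + y\<bar>) powr \<gamma>"
      using C(1)[of "Im s + y"] by (simp add: g_def)
    also have "\<dots> \<le> C * ((1 + \<bar>Im s\<bar>) powr \<gamma> * (1 + \<bar>y\<bar>) powr \<gamma>)"
      using \<gamma> by (intro mult_left_mono shifted_powr_le C(2)) auto
    finally show ?thesis by (simp add: mult.assoc)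
  qed
  define p where "p = (1 - \<alpha> * (1 - \<eta>)) / 2 - \<sigma>"
  have p: "p < 0"
  proof -
    have "\<alpha> * \<eta> \<le> 1 * \<eta>" using \<alpha> \<eta> by (intro mult_right_mono) auto
    then have "\<alpha> * \<eta> \<le> \<sigma> - \<alpha> * \<beta>" using \<eta>(3) by linarith
    moreover have "p = (2 * (\<alpha> * \<beta>) + \<alpha> * \<eta>) / 2 - \<sigma>"
      unfolding p_def half[symmetric] by (simp add: algebra_simps)
    ultimately show ?thesis using \<alpha>\<beta> by (simp add: field_simps)
  qed
  have \<alpha>\<eta>: "0 < \<alpha> * (1 - \<eta>)" "\<alpha> * (1 - \<eta>) < 1"
  proof -
    show "0 < \<alpha> * (1 - \<eta>)" using \<alpha> \<eta> by simp
    have "\<alpha> * (1 - \<eta>) \<le> \<alpha> * 1" using \<alpha> \<eta> by (intro mult_left_mono) auto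
    then show "\<alpha> * (1 - \<eta>) < 1" using \<alpha>(2) unfolding mult_1_right by (rule le_less_trans)
  qed
  have W: "\<forall>\<^sub>F N in sequentially. window_sum d N (real N powr (- (\<alpha> * (1 - \<eta>)))) \<le> (2 powr \<sigma> * sqrt (3 * L)) * real N powr p"
  proof -
    have "(\<lambda>N. real N powr (- (\<alpha> * (1 - \<eta>)))) \<longlonglongrightarrow> 0"
      by (rule tendsto_neg_powr[OF _ filterlim_real_sequentially]) (use \<alpha>\<eta> in simp)
    then have "\<forall>\<^sub>F N in sequentially. real N powr (- (\<alpha> * (1 - \<eta>))) < 1/2" by (rule order_tendstoD) simp
    then show ?thesis using eventually_gt_at_top[of 0]
    proof eventually_elim
      case (elim N)
      let ?\<theta> = "real N powr (- (\<alpha> * (1 - \<eta>)))"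
      have prod: "real N * ?\<theta> = real N powr (1 - \<alpha> * (1 - \<eta>))"
        using elim by (simp add: powr_diff powr_minus_divide)
      have "real N * ?\<theta> \<ge> 1" unfolding prod using elim \<alpha>\<eta> by (intro ge_one_powr_ge_zero) auto
      then have "window_sum d N ?\<theta> \<le> 2 powr \<sigma> * sqrt (3 * L) * (real N powr (-\<sigma>) * sqrt (real N * ?\<theta>))"
        using elim \<sigma>0 by (intro window_sum_bound[OF L _ norm_d]) auto
      also have "real N powr (-\<sigma>) * sqrt (real N * ?\<theta>) = real N powr p"
        unfolding prod powr_half_sqrt[symmetric, OF powr_ge_zero]
        by (simp add: powr_powr powr_add[symmetric] p_def field_simps)
      finally show ?case .
    qed
  qed
  have "(\<lambda>N. dirichlet_partial d N 0) \<longlonglongrightarrow> g 0"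
    by (rule dirichlet_partial_tendsto[OF hol b M E growth A line \<gamma> series \<alpha>(1) \<alpha>\<gamma> \<eta>(1,2) p W])
  then have "dirichlet_term a s sums g 0"
    using term_eq[of 0] by (simp add: sums_def)
  then show ?thesis unfolding dirichlet_converges_def by (rule sums_summable)
qed

theorem corollary3:
  fixes \<beta> :: real and a :: "nat \<Rightarrow> complex" and f :: "complex \<Rightarrow> complex"
  assumes "\<beta> > 0"
    and "a \<in> hardy_H2"
    and "analytic_continuation_to a 0 f"
    and "finite_order 0 f"
    and "\<And>\<sigma>. \<sigma> > 0 \<Longrightarrow> lindelof_mu f \<sigma> \<le> ereal \<beta>"
  shows "conv_abscissa a \<le> ereal (\<beta> / (1 + 2 * \<beta>))"
  unfolding conv_abscissa_def
  using dirichlet_converges_beyond[OF assms]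
  by (intro Inf_lower) (auto simp: half_plane_def)

end
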